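(* Let $p\in[1,+\infty)$ and let $(\varphi_n)_{n\in\mathbb{N}}$ be a sequence of non-negative functions in $L^p(\mathbb{R}_+)$ converging in $L^p$ towards a (non-negative) function $\varphi\in L^p(\mathbb{R}_+)$. Suppose that the local hollows convergence condition holds, that is, $$\forall a>0,\qquad\mathrm{meas}\Big(\big(\mathcal{H}_\infty(\varphi_n)\triangle\mathcal{H}_\infty(\varphi)\big)\cap[0,a]\Big)\;\xrightarrow[n\rightarrow+\infty]{}\;0.$$ Then, up to extraction of a subsequence, $\|\varphi_n^\natural-\varphi^\natural\|_{L^p}\to0$ as $n\to+\infty$. Moreover, if for almost every $\nu\geq0$ $$\mathrm{meas}\big(\{\varphi_n\geq\nu\}\triangle\{\varphi\geq\nu\}\big)\;\xrightarrow[n\rightarrow+\infty]{}\;0,$$ then also $\mathrm{meas}\big(\{\varphi_n^\natural\geq\nu\}\triangle\{\varphi^\natural\geq\nu\}\big)\to0$ for almost every $\nu\ge0$, and the full sequence $(\varphi_n^\natural)$ converges in $L^p$ towards $\varphi^\natural$.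
   Context: $\mathbb{R}_+=[0,+\infty)$, $\mathrm{meas}$ is Lebesgue measure, $A\triangle B=(A\cup B)\setminus(A\cap B)$, $\mathfrak{M}_+(\mathbb{R}_+)$ is the set of non-negative measurable functions on $\mathbb{R}_+$ (identified when equal a.e.), and $\{\varphi\ge\nu\}=\{x\in\mathbb{R}_+:\varphi(x)\ge\nu\}$. Hollows. For $A\subseteq\mathbb{R}_+$ measurable, the essential convex hull is $\mathrm{conv\,ess}\,A:=\bigcap_{\mathrm{meas}(A\triangle B)=0}\mathrm{conv}\,B$. The hollows of $A$ are $\mathcal{H}(A):=(\mathrm{conv\,ess}\,A)\setminus A$ (understood up to null sets). For $\varphi\in\mathfrak{M}_+(\mathbb{R}_+)$ and $\nu\in(0,+\infty]$, $\mathcal{H}_\nu(\varphi):=\bigcup_{\lambda<\nu}\mathcal{H}(\{\varphi\ge\lambda\})$. Tamping. For $\nu>0$ let $x_\nu(\varphi):=\mathrm{inf\,ess}\{\varphi\ge\nu\}$, where $\mathrm{inf\,ess}\,A:=\sup\{a\ge0:\mathrm{meas}(A\cap[0,a])=0\}$, and, when $\mathrm{meas}\{\varphi\ge\nu\}>0$, $y_\nu(\varphi):=x_\nu(\varphi)-\mathrm{meas}(\mathcal{H}_\infty(\varphi)\cap[0,x_\nu(\varphi)])$. Put $S_\nu(\varphi):=[\,y_\nu(\varphi),\,y_\nu(\varphi)+\mathrm{meas}\{\varphi\ge\nu\}\,]$ (meaning $\emptyset$ if $\mathrm{meas}\{\varphi\ge\nu\}=0$, and $[y_\nu(\varphi),+\infty)$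 if it is $+\infty$). These sets are non-increasing in $\nu$. The tamping $\varphi^\natural$ of $\varphi$ is the function whose superlevel sets $\{\varphi^\natural\ge\nu\}$ are the $S_\nu(\varphi)$; explicitly $\varphi^\natural(x):=\sup\{\nu>0: x\in S_\nu(\varphi)\}$ with $\sup\emptyset=0$ (for almost every $\nu$, $\{\varphi^\natural\ge\nu\}=S_\nu(\varphi)$ up to a null set). *)

theory Defs
  imports "HOL-Analysis.Analysis"
begin

text \<open>The underlying measure space is the half-line \<open>{0..}\<close> with Lebesgue measure. Elements of
  \<open>L\<^sup>p\<close> are represented by functions on \<open>real\<close>, of which only the restriction to \<open>{0..}\<close> matters.\<close>

definition superlevel :: "(real \<Rightarrow> 'a::linorder) \<Rightarrow> 'a \<Rightarrow> real set" where
  "superlevel \<phi> \<nu> = {x \<in> {0..}. \<nu> \<le> \<phi> x}"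


subsection \<open>The spaces \<open>L\<^sup>p\<close>\<close>

text \<open>The functions are extended real valued, because a tamped function may be infinite at a point.\<close>

definition ennreal_rpow :: "ennreal \<Rightarrow> real \<Rightarrow> ennreal" where
  "ennreal_rpow a r = (if a = \<infinity> then \<infinity> else ennreal (enn2real a powr r))"

definition Lp_norm :: "real \<Rightarrow> (real \<Rightarrow> ereal) \<Rightarrow> ennreal" where
  "Lp_norm p f =
     ennreal_rpow (\<integral>\<^sup>+x. ennreal_rpow (e2ennreal \<bar>f x\<bar>) p \<partial>lebesgue_on {0..}) (1 / p)"

definition in_Lp :: "real \<Rightarrow> (real \<Rightarrow> ereal) \<Rightarrow> bool" where
  "in_Lp p f \<longleftrightarrow> f \<in> borel_measurable (lebesgue_on {0..}) \<and> Lp_norm p f < \<infinity>"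

text \<open>Where both functions are infinite, the difference \<open>\<infinity> - \<infinity>\<close> is \<open>\<infinity>\<close> in \<^typ>\<open>ereal\<close>;
  for members of \<open>L\<^sup>p\<close> this concerns a null set only.\<close>

definition Lp_tendsto :: "real \<Rightarrow> (nat \<Rightarrow> real \<Rightarrow> ereal) \<Rightarrow> (real \<Rightarrow> ereal) \<Rightarrow> bool" where
  "Lp_tendsto p f g \<longleftrightarrow>
     (\<forall>n. in_Lp p (f n)) \<and> in_Lp p g \<and> (\<lambda>n. Lp_norm p (\<lambda>x. f n x - g x)) \<longlonglongrightarrow> 0"


subsection \<open>Hollows\<close>

definition conv_ess :: "real set \<Rightarrow> real set" where
  "conv_ess A = \<Inter> {convex hull B |B. B \<subseteq> {0..} \<and> sym_diff A B \<in> null_sets lebesgue}"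

definition hollows :: "real set \<Rightarrow> real set" where
  "hollows A = conv_ess A - A"

text \<open>If \<open>\<phi>\<close> is measurable, a modification of \<open>\<phi>\<close> on a null set changes this set by a null set
  only, although the union is uncountable: the sets \<open>conv_ess (superlevel \<phi> \<mu>)\<close> do not
  depend on the representative, and \<open>x\<close> belongs to the union iff
  \<open>\<phi> x < \<mu>\<close> and \<open>x \<in> conv_ess (superlevel \<phi> \<mu>)\<close> for some \<open>\<mu> < \<nu>\<close>.\<close>

definition hollows_below :: "ereal \<Rightarrow> (real \<Rightarrow> real) \<Rightarrow> real set" where
  "hollows_below \<nu> \<phi> = (\<Union>\<mu>\<in>{\<mu>::real. ereal \<mu> < \<nu>}. hollows (superlevel \<phi> \<mu>))"


subsection \<open>Tamping\<close>

text \<open>For a null set \<open>A\<close> the supremum is over an unbounded set and its value is meaningless; it is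
  only used below when \<open>A\<close> has positive measure.\<close>

definition inf_ess :: "real set \<Rightarrow> real" where
  "inf_ess A = Sup {a. 0 \<le> a \<and> emeasure lebesgue (A \<inter> {0..a}) = 0}"

definition tamp_x :: "(real \<Rightarrow> real) \<Rightarrow> real \<Rightarrow> real" where
  "tamp_x \<phi> \<nu> = inf_ess (superlevel \<phi> \<nu>)"

definition tamp_y :: "(real \<Rightarrow> real) \<Rightarrow> real \<Rightarrow> real" where
  "tamp_y \<phi> \<nu> = tamp_x \<phi> \<nu> - measure lebesgue (hollows_below \<infinity> \<phi> \<inter> {0..tamp_x \<phi> \<nu>})"

definition tamp_set :: "(real \<Rightarrow> real) \<Rightarrow> real \<Rightarrow> real set" where
  "tamp_set \<phi> \<nu> =
     (let m = emeasure lebesgue (superlevel \<phi> \<nu>); y = tamp_y \<phi> \<nu>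
      in if m = 0 then {} else if m = \<infinity> then {y..} else {y..y + enn2real m})"

text \<open>Inserting \<open>0\<close> implements the convention that the supremum of the empty set is \<open>0\<close>.\<close>

definition tamping :: "(real \<Rightarrow> real) \<Rightarrow> real \<Rightarrow> ereal" where
  "tamping \<phi> x = Sup (insert 0 {ereal \<nu> |\<nu>. 0 < \<nu> \<and> x \<in> tamp_set \<phi> \<nu>})"

end

theory Submission
  imports Defs
begin

text \<open>
  Write \<open>H\<close> for the set of all hollows and let \<open>T x\<close> be the measure of \<open>[0, x] - H\<close>, so that
  the left end point of \<open>S \<nu>\<close> is \<open>T (x \<nu>)\<close>. A point outside \<open>H\<close> lying between \<open>x \<nu>\<close> and a
  \<open>b\<close> beyond which \<open>{\<phi> \<ge> \<nu>}\<close> is not null must belong to \<open>{\<phi> \<ge> \<nu>}\<close>; hence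
  \<open>T b - T (x \<nu>)\<close> is at most the measure of \<open>{\<phi> \<ge> \<nu>} \<inter> [0, b]\<close>. This one inequality gives
  the monotonicity of the \<open>S \<nu>\<close>, and also the lower bound in \<open>y\<^sub>n \<rightarrow> y\<close> when the superlevel sets
  at height \<open>\<nu>\<close> converge, although \<open>x\<^sub>n \<rightarrow> x\<close> may fail.

  The passage to \<open>L\<^sup>p\<close> rests on the layer cake formula, which expresses the integral of
  \<open>\<bar>f\<^sup>p - g\<^sup>p\<bar>\<close> by the measures of the symmetric differences of the superlevel sets. Those of the
  tampings are dominated by the measures of the superlevel sets of \<open>\<phi>\<^sub>n\<close> and \<open>\<phi>\<close>, because tamping
  preserves them.
\<close>

section \<open>Comparison of |a - b|^p with |a^p - b^p| for p \<ge> 1\<close>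

section \<open>Powers\<close>

text \<open>Convexity of u^p, applied to a + b written as the convex combination of a / (1 - t) and
  b / t. The weight \<open>t\<close> stays free: as it tends to 0 the coefficient of a^p tends to 1,
  at the price of a large coefficient of b^p.\<close>

lemma powr_add_le_convex:
  fixes a b p t :: real
  assumes p: "1 \<le> p" and t: "0 < t" "t < 1" and ab: "0 \<le> a" "0 \<le> b"
  shows "(a + b) powr p \<le> (1 - t) powr (1 - p) * a powr p + t powr (1 - p) * b powr p"
proof -
  have ge1: "1 \<le> u powr (1 - p)" if "0 < u" "u < 1" for u :: real
    using powr_mono2'[of "1 - p" u 1] p that by simp
  consider "a = 0" | "b = 0" | "0 < a" "0 < b" using ab by linarith
  then show ?thesis
  proof cases
    case 1
    then show ?thesis using mult_right_mono[OF ge1[OF t], of "b powr p"] p by simp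
  next
    case 2
    then show ?thesis using mult_right_mono[OF ge1[of "1 - t"], of "a powr p"] p t by simp
  next
    case 3
    have "((1 - t) *\<^sub>R (a / (1 - t)) + t *\<^sub>R (b / t)) powr p
        \<le> (1 - t) * (a / (1 - t)) powr p + t * (b / t) powr p"
      using convex_onD[OF powr_convex[OF p], of t "a / (1 - t)" "b / t"] t 3 by simp
    moreover have "(1 - t) * (a / (1 - t)) powr p = (1 - t) powr (1 - p) * a powr p"
      using t 3 by (simp add: powr_divide powr_diff)
    moreover have "t * (b / t) powr p = t powr (1 - p) * b powr p"
      using t 3 by (simp add: powr_divide powr_diff)
    moreover have "(1 - t) *\<^sub>R (a / (1 - t)) + t *\<^sub>R (b / t) = a + b"
      using t by simp
    ultimately show ?thesis by simp
  qed
qed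

text \<open>The larger of the two numbers is the smaller plus the difference, so the preceding
  inequality applies. For small \<open>t\<close> the first coefficient is small, and the second term
  is controlled by an L^p distance.\<close>

lemma abs_powr_diff_le:
  fixes a b p t :: real
  assumes p: "1 \<le> p" and t: "0 < t" "t < 1" and ab: "0 \<le> a" "0 \<le> b"
  shows "\<bar>a powr p - b powr p\<bar>
    \<le> ((1 - t) powr (1 - p) - 1) * b powr p + t powr (1 - p) * \<bar>a - b\<bar> powr p"
proof -
  have c: "(1 - t) powr (1 - p) \<ge> 1"
    using p t powr_mono2'[of "1 - p" "1 - t" 1] by simp
  have *: "u powr p - v powr p \<le> ((1 - t) powr (1 - p) - 1) * v powr p + t powr (1 - p) * \<bar>u - v\<bar> powr p"
    if "0 \<le> v" "v \<le> u" for u v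
    using powr_add_le_convex[OF p t that(1), of "u - v"] that by (simp add: algebra_simps)
  show ?thesis
  proof (cases "b \<le> a")
    case True
    then show ?thesis using *[of b a] ab p by (simp add: powr_mono2)
  next
    case False
    then have "a powr p \<le> b powr p" using ab p by (intro powr_mono2) auto
    \<comment> \<open>Convexity puts the smaller value \<open>a\<close> into the error term; it may
      be enlarged to \<open>b\<close> because the coefficient is nonnegative.\<close>
    moreover from this have "((1 - t) powr (1 - p) - 1) * a powr p \<le> ((1 - t) powr (1 - p) - 1) * b powr p"
      using c by (intro mult_left_mono) auto
    ultimately show ?thesis using *[of a b] ab False by (simp add: abs_minus_commute)
  qed
qed

text \<open>Superadditivity of u^p: after division by the larger number, both summands lie in
  [0, 1], where s^p \<le> s. This leads back from L^1 convergence of p-th powers to L^p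
  convergence.\<close>

lemma abs_diff_powr_le:
  fixes a b p :: real
  assumes p: "1 \<le> p" and ab: "0 \<le> a" "0 \<le> b"
  shows "\<bar>a - b\<bar> powr p \<le> \<bar>a powr p - b powr p\<bar>"
proof -
  have *: "(u - v) powr p \<le> u powr p - v powr p" if uv: "0 \<le> v" "v \<le> u" for u v
  proof (cases "u = 0")
    case False
    then have u: "0 < u" using uv by simp
    have le: "s powr p \<le> s" if "0 \<le> s" "s \<le> 1" for s :: real
      using powr_mono'[of 1 p s] p that by simp
    have "((u - v) / u) powr p + (v / u) powr p \<le> (u - v) / u + v / u"
      using u uv by (intro add_mono le) auto
    also have "\<dots> = 1" using u by (simp add: field_simps)
    finally show ?thesis using u uv by (simp add: powr_divide field_simps)
  qed (use uv in auto)
  show ?thesis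
  proof (cases "b \<le> a")
    case True then show ?thesis using *[of b a] ab p by (simp add: powr_mono2)
  next
    case False
    then have "a powr p \<le> b powr p" using ab p by (intro powr_mono2) auto
    then show ?thesis using *[of a b] ab False by (simp add: abs_minus_commute)
  qed
qed

section \<open>Layer cake formula for a difference of p-th powers\<close>

section \<open>Layer cake\<close>

lemma sigma_finite_lebesgue_on_half: "sigma_finite_measure (lebesgue_on {0::real..})"
proof -
  have "sigma_finite_measure (lebesgue :: real measure)"
  proof
    show "\<exists>A::real set set. countable A \<and> A \<subseteq> sets lebesgue \<and> \<Union>A = space lebesgue \<and> (\<forall>a\<in>A. emeasure lebesgue a \<noteq> \<infinity>)"
    proof (intro exI conjI)
      show "(\<Union>n. {- real n..real n}) = space lebesgue"
      proof (intro equalityI subsetI)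
        fix x :: real
        obtain n where "\<bar>x\<bar> \<le> real n" using real_arch_simple by blast
        then show "x \<in> (\<Union>n. {- real n..real n})" by (auto intro!: exI[of _ n])
      qed simp
    qed auto
  qed
  then show ?thesis by (rule sigma_finite_measure_restrict_space) auto
qed

text \<open>Fundamental theorem of calculus for u^p; the version with interior derivatives covers
  \<open>a = 0\<close>. The interval is half-open because \<nu> \<le> b and not \<nu> \<le> a
  describes exactly the levels separating \<open>a\<close> from \<open>b\<close>.\<close>

lemma nn_integral_powr_layer:
  fixes a b p :: real
  assumes p: "1 \<le> p" and ab: "0 \<le> a" "a \<le> b"
  shows "(\<integral>\<^sup>+\<nu>. ennreal (p * \<nu> powr (p - 1)) * indicator {a<..b} \<nu> \<partial>lborel) = ennreal (b powr p - a powr p)"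
proof -
  have "((\<lambda>\<nu>. p * \<nu> powr (p - 1)) has_integral (b powr p - a powr p)) {a..b}"
  proof (rule fundamental_theorem_of_calculus_interior)
    show "continuous_on {a..b} (\<lambda>x. x powr p)"
      using p ab by (intro continuous_intros continuous_on_powr') auto
    show "((\<lambda>x. x powr p) has_vector_derivative p * x powr (p - 1)) (at x)" if "x \<in> {a<..<b}" for x
      using that ab by (auto intro!: derivative_eq_intros simp flip: has_real_derivative_iff_has_vector_derivative)
  qed (use ab in auto)
  then have "(\<integral>\<^sup>+\<nu>. ennreal (indicator {a..b} \<nu> * (p * \<nu> powr (p - 1))) \<partial>lborel) = ennreal (b powr p - a powr p)"
    using p by (intro nn_integral_has_integral_lebesgue) auto
  then have "(\<integral>\<^sup>+\<nu>. ennreal (p * \<nu> powr (p - 1)) * indicator {a..b} \<nu> \<partial>lborel) = ennreal (b powr p - a powr p)"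
    by (simp add: indicator_mult_ennreal mult_ac)
  moreover have "(\<integral>\<^sup>+\<nu>. ennreal (p * \<nu> powr (p - 1)) * indicator {a<..b} \<nu> \<partial>lborel)
    = (\<integral>\<^sup>+\<nu>. ennreal (p * \<nu> powr (p - 1)) * indicator {a..b} \<nu> \<partial>lborel)"
    using AE_lborel_singleton[of a] by (intro nn_integral_cong_AE) (auto elim!: eventually_mono simp: indicator_def)
  ultimately show ?thesis by simp
qed

text \<open>A point x lies in the symmetric difference at level \<nu> iff \<nu> is in (min, max] of
  the two values. Integrating the weight over these levels gives the integrand on the left, and
  Tonelli exchanges the integrals. Levels \<nu> \<le> 0 may be cut off since both functions are
  nonnegative almost everywhere.\<close>

lemma layer_cake_diff:
  fixes f g :: "'a \<Rightarrow> real"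
  assumes M: "sigma_finite_measure M" and p: "1 \<le> p"
    and f[measurable]: "f \<in> borel_measurable M" and g[measurable]: "g \<in> borel_measurable M"
    and nn: "AE x in M. 0 \<le> f x" "AE x in M. 0 \<le> g x"
  shows "(\<integral>\<^sup>+x. ennreal \<bar>f x powr p - g x powr p\<bar> \<partial>M)
    = (\<integral>\<^sup>+\<nu>. ennreal (p * \<nu> powr (p - 1)) * emeasure M (sym_diff {x \<in> space M. \<nu> \<le> f x} {x \<in> space M. \<nu> \<le> g x})
         * indicator {0<..} \<nu> \<partial>lborel)"
proof -
  interpret M: sigma_finite_measure M by fact
  interpret pair_sigma_finite M lborel ..
  let ?h = "\<lambda>x \<nu>. ennreal (p * \<nu> powr (p - 1)) * indicator {min (f x) (g x)<..max (f x) (g x)} \<nu> * indicator {0<..} \<nu>"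
  let ?S = "\<lambda>\<nu>. sym_diff {x \<in> space M. \<nu> \<le> f x} {x \<in> space M. \<nu> \<le> g x}"
  have meas: "case_prod ?h \<in> borel_measurable (M \<Otimes>\<^sub>M lborel)"
    unfolding greaterThanAtMost_iff indicator_def by measurable
  have "(\<integral>\<^sup>+x. ennreal \<bar>f x powr p - g x powr p\<bar> \<partial>M) = (\<integral>\<^sup>+x. (\<integral>\<^sup>+\<nu>. ?h x \<nu> \<partial>lborel) \<partial>M)"
  proof (rule nn_integral_cong_AE, use nn in eventually_elim)
    fix x assume x: "0 \<le> f x" "0 \<le> g x"
    have "(\<integral>\<^sup>+\<nu>. ?h x \<nu> \<partial>lborel) = (\<integral>\<^sup>+\<nu>. ennreal (p * \<nu> powr (p - 1)) * indicator {min (f x) (g x)<..max (f x) (g x)} \<nu> \<partial>lborel)"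
      using x by (intro nn_integral_cong) (auto simp: indicator_def)
    also have "\<dots> = ennreal (max (f x) (g x) powr p - min (f x) (g x) powr p)"
      using x by (intro nn_integral_powr_layer[OF p]) auto
    also have "max (f x) (g x) powr p - min (f x) (g x) powr p = \<bar>f x powr p - g x powr p\<bar>"
      using x p powr_mono2[of p "f x" "g x"] powr_mono2[of p "g x" "f x"] by (auto simp: max_def min_def)
    finally show "ennreal \<bar>f x powr p - g x powr p\<bar> = (\<integral>\<^sup>+\<nu>. ?h x \<nu> \<partial>lborel)" by simp
  qed
  also have "\<dots> = (\<integral>\<^sup>+\<nu>. (\<integral>\<^sup>+x. ?h x \<nu> \<partial>M) \<partial>lborel)"
    using Fubini'[OF meas] by simp
  also have "\<dots> = (\<integral>\<^sup>+\<nu>. ennreal (p * \<nu> powr (p - 1)) * emeasure M (?S \<nu>) * indicator {0<..} \<nu> \<partial>lborel)"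
  proof (rule nn_integral_cong)
    fix \<nu>
    have "(\<integral>\<^sup>+x. ?h x \<nu> \<partial>M) = (\<integral>\<^sup>+x. ennreal (p * \<nu> powr (p - 1)) * indicator {0<..} \<nu> * indicator (?S \<nu>) x \<partial>M)"
      by (intro nn_integral_cong) (auto simp: indicator_def max_def min_def split: if_splits)
    also have "\<dots> = ennreal (p * \<nu> powr (p - 1)) * indicator {0<..} \<nu> * emeasure M (?S \<nu>)"
      by (rule nn_integral_cmult_indicator) measurable
    finally show "(\<integral>\<^sup>+x. ?h x \<nu> \<partial>M) = ennreal (p * \<nu> powr (p - 1)) * emeasure M (?S \<nu>) * indicator {0<..} \<nu>"
      by (simp add: mult_ac)
  qed
  finally show ?thesis .
qed

text \<open>The symmetric difference is a section of the measurable set of pairs at which the two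
  comparisons disagree.\<close>

lemma borel_measurable_emeasure_sym_diff_levels:
  fixes f g :: "'a \<Rightarrow> real"
  assumes M: "sigma_finite_measure M"
    and [measurable]: "f \<in> borel_measurable M" "g \<in> borel_measurable M"
  shows "(\<lambda>\<nu>. emeasure M (sym_diff {x \<in> space M. \<nu> \<le> f x} {x \<in> space M. \<nu> \<le> g x})) \<in> borel_measurable borel"
proof -
  interpret M: sigma_finite_measure M by fact
  have "(\<lambda>\<nu>. emeasure M {x \<in> space M. (\<nu> \<le> f x) \<noteq> (\<nu> \<le> g x)}) \<in> borel_measurable borel"
    by measurable
  moreover have "sym_diff {x \<in> space M. \<nu> \<le> f x} {x \<in> space M. \<nu> \<le> g x} = {x \<in> space M. (\<nu> \<le> f x) \<noteq> (\<nu> \<le> g x)}" for \<nu>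
    by auto
  ultimately show ?thesis by simp
qed

section \<open>Essential convex hull and essential infimum on the line\<close>

section \<open>Essential convex hulls\<close>

text \<open>If one side of x carries only a null part of \<open>A\<close>, deleting that part leaves
  a set inside an open half-line that misses x. Otherwise every modification \<open>B\<close> keeps
  points on both sides, and the segment joining them contains x.\<close>

lemma conv_ess_iff:
  assumes A: "A \<subseteq> {0..}"
  shows "x \<in> conv_ess A \<longleftrightarrow> \<not> negligible (A \<inter> {..x}) \<and> \<not> negligible (A \<inter> {x..})"
proof (intro iffI conjI notI)
  assume x: "x \<in> conv_ess A"
  show False if n: "negligible (A \<inter> {..x})"
  proof -
    have "sym_diff A (A \<inter> {x<..}) = A \<inter> {..x}" by auto
    then have "x \<in> convex hull (A \<inter> {x<..})"
      using x A n unfolding conv_ess_def negligible_iff_null_sets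
      by (intro InterD[OF x[unfolded conv_ess_def]] CollectI exI[of _ "A \<inter> {x<..}"]) auto
    moreover have "convex hull (A \<inter> {x<..}) \<subseteq> {x<..}" by (rule hull_minimal) auto
    ultimately show False by auto
  qed
  show False if n: "negligible (A \<inter> {x..})"
  proof -
    have "sym_diff A (A \<inter> {..<x}) = A \<inter> {x..}" by auto
    then have "x \<in> convex hull (A \<inter> {..<x})"
      using x A n unfolding conv_ess_def negligible_iff_null_sets
      by (intro InterD[OF x[unfolded conv_ess_def]] CollectI exI[of _ "A \<inter> {..<x}"]) auto
    moreover have "convex hull (A \<inter> {..<x}) \<subseteq> {..<x}" by (rule hull_minimal) auto
    ultimately show False by auto
  qed
next
  assume x: "\<not> negligible (A \<inter> {..x}) \<and> \<not> negligible (A \<inter> {x..})"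
  show "x \<in> conv_ess A"
    unfolding conv_ess_def
  proof (clarify)
    fix B assume "sym_diff A B \<in> null_sets lebesgue"
    then have n: "negligible (sym_diff A B)" by (simp only: negligible_iff_null_sets)
    have "B \<inter> {..x} \<noteq> {}"
    proof
      assume "B \<inter> {..x} = {}"
      then have "A \<inter> {..x} \<subseteq> sym_diff A B" by auto
      then show False using x n negligible_subset by blast
    qed
    moreover have "B \<inter> {x..} \<noteq> {}"
    proof
      assume "B \<inter> {x..} = {}"
      then have "A \<inter> {x..} \<subseteq> sym_diff A B" by auto
      then show False using x n negligible_subset by blast
    qed
    ultimately obtain u v where uv: "u \<in> B" "u \<le> x" "v \<in> B" "x \<le> v" by auto
    then have "x \<in> closed_segment u v" by (simp add: closed_segment_eq_real_ivl)
    then show "x \<in> convex hull B"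
      using uv by (meson closed_segment_subset_convex_hull hull_inc subsetD)
  qed
qed

lemma sets_lebesgue_convex_real:
  fixes S :: "real set"
  assumes "convex S"
  shows "S \<in> sets lebesgue"
  using real_interval_borel_measurable[of S] assms by (simp add: is_interval_convex_1)

lemma convex_conv_ess: "convex (conv_ess A)"
  unfolding conv_ess_def by (intro convex_Inter) auto

context
  fixes A :: "real set"
  assumes A: "A \<in> sets lebesgue" "A \<subseteq> {0..}" "\<not> negligible A"
begin

lemma negligible_atMost_Icc: "emeasure lebesgue (A \<inter> {0..a}) = 0 \<longleftrightarrow> negligible (A \<inter> {..a})"
proof -
  have "A \<inter> {..a} = A \<inter> {0..a}" using A by auto
  moreover have "A \<inter> {0..a} \<in> sets lebesgue" using A by auto
  ultimately show ?thesis by (simp add: negligible_iff_null_sets null_sets_def)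
qed

text \<open>These facts make the supremum in \<open>inf_ess\<close> meaningful. Were it over an
  unbounded set, \<open>A\<close> would be a countable union of null sets.\<close>

lemma inf_ess_set:
  shows "bdd_above {a. 0 \<le> a \<and> emeasure lebesgue (A \<inter> {0..a}) = 0}"
    and "0 \<in> {a. 0 \<le> a \<and> emeasure lebesgue (A \<inter> {0..a}) = 0}"
proof -
  show "bdd_above {a. 0 \<le> a \<and> emeasure lebesgue (A \<inter> {0..a}) = 0}" (is "bdd_above ?Z")
  proof (rule ccontr)
    assume nb: "\<not> bdd_above ?Z"
    have "negligible (A \<inter> {..real n})" for n
    proof -
      obtain a where "a \<in> ?Z" "real n < a" using nb unfolding bdd_above_def by (meson not_le)
      then show ?thesis
        using negligible_atMost_Icc[of a] negligible_subset[of "A \<inter> {..a}" "A \<inter> {..real n}"] by force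
    qed
    then have "negligible (\<Union>n. A \<inter> {..real n})" by (intro negligible_Union_nat)
    moreover have "(\<Union>n. A \<inter> {..real n}) = A" using real_arch_simple by auto
    ultimately show False using A by simp
  qed
  have "negligible (A \<inter> {..0})" by (rule negligible_subset[of "{0}"]) (use A(2) in auto)
  then show "0 \<in> ?Z" using negligible_atMost_Icc by auto
qed

lemma inf_ess_nonneg: "0 \<le> inf_ess A"
  unfolding inf_ess_def using cSup_upper[OF inf_ess_set(2,1)] .

text \<open>The supremum is attained, because a countable union of null initial segments is null;
  hence the equivalence includes the end point.\<close>

lemma negligible_atMost_iff: "negligible (A \<inter> {..x}) \<longleftrightarrow> x \<le> inf_ess A"
proof
  assume n: "negligible (A \<inter> {..x})"
  show "x \<le> inf_ess A"
  proof (cases "0 \<le> x")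
    case True
    then show ?thesis unfolding inf_ess_def
      using n negligible_atMost_Icc by (intro cSup_upper inf_ess_set(1)) auto
  qed (use inf_ess_nonneg in auto)
next
  have less: "negligible (A \<inter> {..x})" if "x < inf_ess A" for x
  proof -
    have "\<exists>a\<in>{a. 0 \<le> a \<and> emeasure lebesgue (A \<inter> {0..a}) = 0}. x < a"
      using inf_ess_set(2) that[unfolded inf_ess_def] by (intro less_cSupD) blast+
    then obtain a where "0 \<le> a" "emeasure lebesgue (A \<inter> {0..a}) = 0" "x < a" by auto
    then show ?thesis
      using negligible_atMost_Icc[of a] negligible_subset[of "A \<inter> {..a}" "A \<inter> {..x}"] by force
  qed
  assume x: "x \<le> inf_ess A"
  have "x - 1 / real (Suc n) < inf_ess A" for n
    by (rule less_le_trans[OF _ x]) simp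
  \<comment> \<open>The segments ending at x - 1 / (n + 1) exhaust everything strictly below x; the
    point x itself is added by hand.\<close>
  then have "negligible ({x} \<union> (\<Union>n. A \<inter> {..x - 1 / real (Suc n)}))"
    by (intro negligible_Un negligible_Union_nat less) auto
  moreover have "A \<inter> {..x} \<subseteq> {x} \<union> (\<Union>n. A \<inter> {..x - 1 / real (Suc n)})"
  proof
    fix y assume y: "y \<in> A \<inter> {..x}"
    show "y \<in> {x} \<union> (\<Union>n. A \<inter> {..x - 1 / real (Suc n)})"
    proof (cases "y = x")
      case False
      then obtain n where "1 / real (Suc n) < x - y"
        using y reals_Archimedean[of "x - y"] by (auto simp: field_simps)
      then show ?thesis using y by (auto intro!: exI[of _ n])
    qed auto
  qed
  ultimately show "negligible (A \<inter> {..x})" by (rule negligible_subset)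
qed

end

section \<open>Measurability of the hollows; the tamped sets of a single function\<close>

section \<open>The tamping of a function\<close>

lemma sets_superlevel:
  fixes f :: "real \<Rightarrow> 'b::{linorder_topology, second_countable_topology}"
  assumes "f \<in> borel_measurable (lebesgue_on {0..})"
  shows "superlevel f \<nu> \<in> sets lebesgue"
proof -
  have "{x \<in> space (lebesgue_on {0..}). \<nu> \<le> f x} \<in> sets (lebesgue_on {0..})"
    using assms by measurable
  moreover have "{x \<in> space (lebesgue_on {0..}). \<nu> \<le> f x} = superlevel f \<nu>"
    by (auto simp: superlevel_def)
  ultimately show ?thesis by (subst (asm) sets_restrict_space_iff) auto
qed

text \<open>These are the properties of an L^p function on which the construction rests. Levels are
  kept positive: for nonnegative \<open>\<phi>\<close> the superlevel set at 0 is the whole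
  half-line.\<close>

locale tampable =
  fixes \<phi> :: "real \<Rightarrow> real"
  assumes meas: "\<phi> \<in> borel_measurable (lebesgue_on {0..})"
    and fin: "\<And>\<nu>. 0 < \<nu> \<Longrightarrow> emeasure lebesgue (superlevel \<phi> \<nu>) < \<infinity>"
begin

abbreviation "A \<equiv> superlevel \<phi>"
abbreviation "H \<equiv> hollows_below \<infinity> \<phi>"
abbreviation "X \<equiv> tamp_x \<phi>"
abbreviation "S \<equiv> tamp_set \<phi>"

text \<open>This is the function \<open>T\<close> of the introduction: it closes up the hollows by
  moving x to the left by their length in [0, x].\<close>

definition solid :: "real \<Rightarrow> real" where
  "solid x = measure lebesgue ({0..x} - H)"

lemma superlevel_sets[measurable, simp]: "A \<nu> \<in> sets lebesgue"
  using meas by (rule sets_superlevel)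

lemma superlevel_nonneg: "A \<nu> \<subseteq> {0..}"
  by (auto simp: superlevel_def)

lemma superlevel_antimono: "\<mu> \<le> \<nu> \<Longrightarrow> A \<nu> \<subseteq> A \<mu>"
  by (auto simp: superlevel_def)

lemma superlevel_lmeasurable: "0 < \<nu> \<Longrightarrow> A \<nu> \<in> lmeasurable"
  using fin[of \<nu>] by (auto simp: fmeasurable_def)

text \<open>Mostly used in contrapositive form: a point outside \<open>H\<close> with non-null parts
  of \<open>A \<mu>\<close> on both sides satisfies \<mu> \<le> \<phi> x.\<close>

lemma hollows_iff:
  "x \<in> H \<longleftrightarrow> 0 \<le> x \<and> (\<exists>\<mu>. \<phi> x < \<mu> \<and> \<not> negligible (A \<mu> \<inter> {..x}) \<and> \<not> negligible (A \<mu> \<inter> {x..}))"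
proof -
  have "0 \<le> x" if "\<not> negligible (A \<mu> \<inter> {..x})" for \<mu>
  proof (rule ccontr)
    assume "\<not> 0 \<le> x"
    then have "A \<mu> \<inter> {..x} = {}" using superlevel_nonneg[of \<mu>] by auto
    then show False using that by simp
  qed
  then show ?thesis
    unfolding hollows_below_def hollows_def
    by (auto simp: conv_ess_iff[OF superlevel_nonneg]) (auto simp: superlevel_def not_le)
qed

text \<open>The uncountable union reduces to rational levels: a rational q between \<phi> x and
  \<mu> still excludes x from \<open>A q\<close>, while the larger set \<open>A q\<close> remains
  non-null on both sides. Each essential hull is convex, hence measurable.\<close>

lemma hollows_sets[measurable, simp]: "H \<in> sets lebesgue"
proof -
  have "H = (\<Union>q\<in>\<rat>. hollows (A q))"
  proof
    show "H \<subseteq> (\<Union>q\<in>\<rat>. hollows (A q))"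
    proof
      fix x assume "x \<in> H"
      then obtain \<mu> where \<mu>: "\<phi> x < \<mu>" "\<not> negligible (A \<mu> \<inter> {..x})" "\<not> negligible (A \<mu> \<inter> {x..})"
        by (auto simp: hollows_iff)
      obtain q where q: "q \<in> \<rat>" "\<phi> x < q" "q < \<mu>" using Rats_dense_in_real[OF \<mu>(1)] by auto
      have "A \<mu> \<subseteq> A q" using q by (intro superlevel_antimono) auto
      then have "\<not> negligible (A q \<inter> {..x})" "\<not> negligible (A q \<inter> {x..})"
        using \<mu> by (meson Int_mono negligible_subset order_refl)+
      then show "x \<in> (\<Union>q\<in>\<rat>. hollows (A q))"
        using q by (auto simp: hollows_def conv_ess_iff[OF superlevel_nonneg]) (auto simp: superlevel_def)
    qed
    show "(\<Union>q\<in>\<rat>. hollows (A q)) \<subseteq> H" by (auto simp: hollows_below_def)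
  qed
  moreover have "(\<Union>q\<in>\<rat>. hollows (A q)) \<in> sets lebesgue"
    unfolding hollows_def
    by (intro sets.countable_UN'' sets.Diff sets_lebesgue_convex_real convex_conv_ess countable_rat superlevel_sets)
  ultimately show ?thesis by simp
qed

lemma Icc_minus_hollows_lmeasurable: "{a..b} - H \<in> lmeasurable"
  by (intro fmeasurable_Diff) auto

lemma solid_diff:
  assumes "0 \<le> a" "a \<le> b"
  shows "solid b - solid a = measure lebesgue ({a..b} - H)"
proof -
  have "solid b = measure lebesgue (({0..a} - H) \<union> ({a..b} - H))"
    unfolding solid_def using assms by (intro arg_cong[where f = "measure lebesgue"]) auto
  also have "\<dots> = solid a + measure lebesgue ({a..b} - H) - measure lebesgue (({0..a} - H) \<inter> ({a..b} - H))"
    unfolding solid_def by (intro measure_Un3 Icc_minus_hollows_lmeasurable)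
  also have "measure lebesgue (({0..a} - H) \<inter> ({a..b} - H)) = 0"
    by (rule negligible_imp_measure0, rule negligible_subset[of "{a}"]) auto
  finally show ?thesis by simp
qed

lemma solid_mono: "0 \<le> a \<Longrightarrow> a \<le> b \<Longrightarrow> solid a \<le> solid b"
  using solid_diff[of a b] measure_nonneg[of lebesgue "{a..b} - H"] by linarith

lemma solid_lipschitz: "0 \<le> a \<Longrightarrow> a \<le> b \<Longrightarrow> solid b \<le> solid a + (b - a)"
  using solid_diff[of a b] measure_mono_fmeasurable[of "{a..b} - H" "{a..b}" lebesgue] by auto

lemma solid_nonneg: "0 \<le> solid a"
  by (simp add: solid_def)

lemma tamp_x_nonneg: "\<not> negligible (A \<nu>) \<Longrightarrow> 0 \<le> X \<nu>"
  unfolding tamp_x_def by (intro inf_ess_nonneg superlevel_nonneg) auto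

lemma negligible_below_tamp_x:
  "\<not> negligible (A \<nu>) \<Longrightarrow> negligible (A \<nu> \<inter> {..x}) \<longleftrightarrow> x \<le> X \<nu>"
  unfolding tamp_x_def by (intro negligible_atMost_iff superlevel_nonneg) auto

lemma tamp_y_eq: 
  assumes "\<not> negligible (A \<nu>)"
  shows "tamp_y \<phi> \<nu> = solid (X \<nu>)"
proof -
  have "measure lebesgue ({0..X \<nu>} - H \<inter> {0..X \<nu>}) = measure lebesgue {0..X \<nu>} - measure lebesgue (H \<inter> {0..X \<nu>})"
    by (rule measure_Diff) (auto simp: emeasure_lborel_Icc_eq)
  moreover have "{0..X \<nu>} - H \<inter> {0..X \<nu>} = {0..X \<nu>} - H" by auto
  ultimately show ?thesis
    using tamp_x_nonneg[OF assms] by (simp add: tamp_y_def solid_def Int_commute)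
qed

text \<open>The key inequality. A point strictly between \<open>X \<nu>\<close> and \<open>b\<close>
  has a non-null part of \<open>A \<nu>\<close> on its left, by the choice of
  \<open>X \<nu>\<close>, and on its right, by the assumption on \<open>b\<close>. If it is outside
  \<open>H\<close> it must therefore belong to \<open>A \<nu>\<close>. For \<open>b\<close> below
  \<open>X \<nu>\<close> the left side is at most 0.\<close>

lemma solid_diff_le:
  assumes b: "\<not> negligible (A \<nu> \<inter> {b..})" "0 \<le> b"
  shows "solid b - solid (X \<nu>) \<le> measure lebesgue (A \<nu> \<inter> {0..b})"
proof (cases "X \<nu> \<le> b")
  case True
  have nn: "\<not> negligible (A \<nu>)" using b negligible_subset[of "A \<nu>" "A \<nu> \<inter> {b..}"] by auto
  \<comment> \<open>At \<open>X \<nu>\<close> itself the part of \<open>A \<nu>\<close> to the left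
    is null and the argument fails; the end points are set aside as a null set.\<close>
  have sub: "{X \<nu>..b} - H \<subseteq> (A \<nu> \<inter> {0..b}) \<union> ({X \<nu>} \<union> {b})"
  proof
    fix x assume x: "x \<in> {X \<nu>..b} - H"
    show "x \<in> (A \<nu> \<inter> {0..b}) \<union> ({X \<nu>} \<union> {b})"
    proof (cases "x = X \<nu> \<or> x = b")
      case False
      have "\<not> negligible (A \<nu> \<inter> {..x})"
        using negligible_below_tamp_x[OF nn] x False by auto
      moreover have "\<not> negligible (A \<nu> \<inter> {x..})"
        using b x negligible_subset[of "A \<nu> \<inter> {x..}" "A \<nu> \<inter> {b..}"] by force
      ultimately have "\<nu> \<le> \<phi> x" using x tamp_x_nonneg[OF nn] by (force simp: hollows_iff)
      then show ?thesis using x tamp_x_nonneg[OF nn] by (auto simp: superlevel_def)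
    qed auto
  qed
  have lm: "A \<nu> \<inter> {0..b} \<in> lmeasurable"
    by (intro bounded_set_imp_lmeasurable) (auto intro: bounded_subset[of "{0..b}"])
  have "solid b - solid (X \<nu>) = measure lebesgue ({X \<nu>..b} - H)"
    using True tamp_x_nonneg[OF nn] by (intro solid_diff)
  also have "\<dots> \<le> measure lebesgue ((A \<nu> \<inter> {0..b}) \<union> ({X \<nu>} \<union> {b}))"
    by (intro measure_mono_fmeasurable sub fmeasurable.Un lm negligible_imp_measurable) auto
  also have "\<dots> = measure lebesgue (A \<nu> \<inter> {0..b})"
    by (rule measure_Un_null_set) (auto simp flip: negligible_iff_null_sets)
  finally show ?thesis .
next
  case False
  then show ?thesis
    using solid_mono[of b "X \<nu>"] b by (simp add: add_increasing2 algebra_simps)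
qed

text \<open>Finiteness at positive levels excludes the unbounded interval, and \<open>solid\<close>
  absorbs the hollow correction in \<open>tamp_y\<close>.\<close>

lemma tamp_set_eq:
  assumes "0 < \<nu>"
  shows "S \<nu> = (if negligible (A \<nu>) then {} else {solid (X \<nu>)..solid (X \<nu>) + measure lebesgue (A \<nu>)})"
proof (cases "negligible (A \<nu>)")
  case True
  then have "emeasure lebesgue (A \<nu>) = 0" by (auto simp: negligible_iff_null_sets)
  then show ?thesis using True by (simp add: tamp_set_def)
next
  case False
  then have "emeasure lebesgue (A \<nu>) \<noteq> 0" by (auto simp: negligible_iff_null_sets null_sets_def)
  then show ?thesis using False fin[OF assms] tamp_y_eq[OF False] 
    by (simp add: tamp_set_def Let_def measure_def)
qed

lemma tamp_set_lmeasurable: "0 < \<nu> \<Longrightarrow> S \<nu> \<in> lmeasurable"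
  by (auto simp: tamp_set_eq)

lemma tamp_set_borel: "0 < \<nu> \<Longrightarrow> S \<nu> \<in> sets borel"
  by (auto simp: tamp_set_eq)

lemma tamp_set_nonneg: "0 < \<nu> \<Longrightarrow> S \<nu> \<subseteq> {0..}"
  using solid_nonneg by (auto simp: tamp_set_eq intro: order_trans)

lemma measure_tamp_set: "0 < \<nu> \<Longrightarrow> measure lebesgue (S \<nu>) = measure lebesgue (A \<nu>)"
  using negligible_imp_measure0[of "A \<nu>"] by (auto simp: tamp_set_eq)

text \<open>Supplies the assumption of \<open>solid_diff_le\<close> at
  \<open>b = X \<nu>\<close>.\<close>

lemma not_negligible_above_tamp_x:
  assumes "\<not> negligible (A \<nu>)"
  shows "\<not> negligible (A \<nu> \<inter> {X \<nu>..})"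
proof
  assume "negligible (A \<nu> \<inter> {X \<nu>..})"
  then have "negligible ((A \<nu> \<inter> {..X \<nu>}) \<union> (A \<nu> \<inter> {X \<nu>..}))"
    using negligible_below_tamp_x[OF assms] by (intro negligible_Un) simp_all
  moreover have "(A \<nu> \<inter> {..X \<nu>}) \<union> (A \<nu> \<inter> {X \<nu>..}) = A \<nu>" by auto
  ultimately show False using assms by simp
qed

text \<open>Left end points are ordered because \<open>X\<close> and \<open>solid\<close> are
  monotone. For the right ones, the gap between the left end points is at most the measure of the
  part of \<open>A \<mu>\<close> up to \<open>X \<nu>\<close>, whereas \<open>A \<nu>\<close> lies
  essentially beyond \<open>X \<nu>\<close>; both parts fit disjointly into
  \<open>A \<mu>\<close>.\<close>

lemma tamp_set_antimono:
  assumes "0 < \<mu>" "\<mu> \<le> \<nu>"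
  shows "S \<nu> \<subseteq> S \<mu>"
proof (cases "negligible (A \<nu>)")
  case True
  then show ?thesis using assms by (simp add: tamp_set_eq)
next
  case n: False
  have sub: "A \<nu> \<subseteq> A \<mu>" using assms(2) by (rule superlevel_antimono)
  then have n': "\<not> negligible (A \<mu>)" using n negligible_subset by blast
  have below: "negligible (A \<nu> \<inter> {..X \<nu>})" using negligible_below_tamp_x[OF n] by simp
  have "negligible (A \<mu> \<inter> {..X \<mu>})" using negligible_below_tamp_x[OF n'] by simp
  then have "negligible (A \<nu> \<inter> {..X \<mu>})" by (rule negligible_subset) (use sub in auto)
  then have X: "X \<mu> \<le> X \<nu>" using negligible_below_tamp_x[OF n] by simp
  have "\<not> negligible (A \<nu> \<inter> {X \<nu>..})" using n by (rule not_negligible_above_tamp_x)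
  then have "\<not> negligible (A \<mu> \<inter> {X \<nu>..})" using sub negligible_subset by (meson Int_mono order_refl)
  then have gap: "solid (X \<nu>) - solid (X \<mu>) \<le> measure lebesgue (A \<mu> \<inter> {0..X \<nu>})"
    using tamp_x_nonneg[OF n] by (rule solid_diff_le)
  have lm: "A \<mu> \<in> lmeasurable" "A \<nu> \<in> lmeasurable" using assms superlevel_lmeasurable by auto
  \<comment> \<open>Cutting at the open half-line loses only a null set and makes the two parts of
    \<open>A \<mu>\<close> disjoint.\<close>
  have "measure lebesgue (A \<nu> \<inter> {X \<nu><..}) = measure lebesgue (A \<nu>)"
  proof (rule measure_negligible_symdiff[OF lm(2)])
    show "negligible (sym_diff (A \<nu>) (A \<nu> \<inter> {X \<nu><..}))"
      by (rule negligible_subset[OF below]) auto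
  qed
  moreover have "measure lebesgue (A \<mu> \<inter> {0..X \<nu>}) + measure lebesgue (A \<nu> \<inter> {X \<nu><..})
      = measure lebesgue ((A \<mu> \<inter> {0..X \<nu>}) \<union> (A \<nu> \<inter> {X \<nu><..}))"
  proof (subst measure_Un3)
    have "A \<mu> \<inter> {0..X \<nu>} \<inter> (A \<nu> \<inter> {X \<nu><..}) = {}" by auto
    then show "measure lebesgue (A \<mu> \<inter> {0..X \<nu>}) + measure lebesgue (A \<nu> \<inter> {X \<nu><..})
      = measure lebesgue (A \<mu> \<inter> {0..X \<nu>}) + measure lebesgue (A \<nu> \<inter> {X \<nu><..})
        - measure lebesgue (A \<mu> \<inter> {0..X \<nu>} \<inter> (A \<nu> \<inter> {X \<nu><..}))"
      by (simp only: measure_empty diff_zero)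
  qed (use lm in \<open>auto intro!: fmeasurable_Int_fmeasurable\<close>)
  moreover have "\<dots> \<le> measure lebesgue (A \<mu>)"
    using lm sub by (intro measure_mono_fmeasurable sets.Un sets.Int) auto
  ultimately have "solid (X \<nu>) + measure lebesgue (A \<nu>) \<le> solid (X \<mu>) + measure lebesgue (A \<mu>)"
    using gap by linarith
  then show ?thesis
    using solid_mono[OF tamp_x_nonneg[OF n'] X] assms n n' by (auto simp: tamp_set_eq)
qed


section \<open>Superlevel sets, measurability and almost everywhere finiteness of the
  tamping\<close>

lemma less_tamping_iff:
  assumes "0 \<le> y"
  shows "y < tamping \<phi> x \<longleftrightarrow> (\<exists>\<nu>>0. y < ereal \<nu> \<and> x \<in> S \<nu>)"
  unfolding tamping_def less_Sup_iff using assms by auto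

text \<open>Since the \<open>S \<mu>\<close> decrease, a supremum of at least \<nu> means membership
  at all smaller levels. Membership in \<open>S \<nu>\<close> itself may fail, as the supremum need
  not be attained.\<close>

lemma le_tamping_iff:
  assumes "0 < \<nu>"
  shows "ereal \<nu> \<le> tamping \<phi> x \<longleftrightarrow> (\<forall>\<mu>. 0 < \<mu> \<and> \<mu> < \<nu> \<longrightarrow> x \<in> S \<mu>)"
proof
  assume le: "ereal \<nu> \<le> tamping \<phi> x"
  show "\<forall>\<mu>. 0 < \<mu> \<and> \<mu> < \<nu> \<longrightarrow> x \<in> S \<mu>"
  proof (intro allI impI)
    fix \<mu> assume \<mu>: "0 < \<mu> \<and> \<mu> < \<nu>"
    then have "ereal \<mu> < tamping \<phi> x" using le by (auto intro: less_le_trans[OF _ le])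
    then obtain \<kappa> where "\<mu> < \<kappa>" "x \<in> S \<kappa>" using \<mu> less_tamping_iff[of "ereal \<mu>" x] by auto
    then show "x \<in> S \<mu>" using tamp_set_antimono[of \<mu> \<kappa>] \<mu> by auto
  qed
next
  assume *: "\<forall>\<mu>. 0 < \<mu> \<and> \<mu> < \<nu> \<longrightarrow> x \<in> S \<mu>"
  show "ereal \<nu> \<le> tamping \<phi> x"
  proof (rule dense_le)
    fix y assume y: "y < ereal \<nu>"
    show "y \<le> tamping \<phi> x"
    proof (cases "y \<le> 0")
      case True
      have "0 \<le> tamping \<phi> x" unfolding tamping_def by (rule Sup_upper) simp
      then show ?thesis using True by simp
    next
      case False
      then obtain r where r: "y = ereal r" "0 < r" "r < \<nu>" using y by (cases y) auto
      then have "x \<in> S r" using * by simp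
      then show ?thesis unfolding tamping_def r(1) by (intro Sup_upper) (use r in auto)
    qed
  qed
qed

lemma tamping_nonneg: "0 \<le> tamping \<phi> x"
  unfolding tamping_def by (rule Sup_upper) simp

text \<open>By monotonicity of the \<open>S \<nu>\<close>, a strict superlevel set at height y \<ge>
  0 is the union of the intervals \<open>S q\<close> over positive rationals q > y.\<close>

lemma tamping_measurable: "tamping \<phi> \<in> borel_measurable (lebesgue_on {0..})"
proof -
  have "tamping \<phi> \<in> borel_measurable borel"
  proof (rule borel_measurableI_greater)
    fix y :: ereal
    show "{x \<in> space borel. y < tamping \<phi> x} \<in> sets borel"
    proof (cases "0 \<le> y")
      case True
      have "{x \<in> space borel. y < tamping \<phi> x} = (\<Union>q\<in>{q\<in>\<rat>. 0 < q \<and> y < ereal q}. S q)" (is "?L = ?R")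
      proof
        show "?L \<subseteq> ?R"
        proof
          fix x assume "x \<in> ?L"
          then obtain \<nu> where \<nu>: "0 < \<nu>" "y < ereal \<nu>" "x \<in> S \<nu>"
            using less_tamping_iff[OF True] by auto
          obtain r where r: "y = ereal r" "0 \<le> r" using True \<nu> by (cases y) auto
          then obtain q where q: "q \<in> \<rat>" "r < q" "q < \<nu>" using Rats_dense_in_real[of r \<nu>] \<nu> by auto
          then have "x \<in> S q" using tamp_set_antimono[of q \<nu>] \<nu> r by auto
          then show "x \<in> ?R" using q r by auto
        qed
        show "?R \<subseteq> ?L" using less_tamping_iff[OF True] by auto
      qed
      moreover have "?R \<in> sets borel"
        by (rule sets.countable_UN'') (auto intro: tamp_set_borel countable_subset[OF _ countable_rat])
      ultimately show ?thesis by simp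
    next
      case False
      then have "{x \<in> space borel. y < tamping \<phi> x} = UNIV"
        using less_le_trans[OF _ tamping_nonneg] by auto
      then show ?thesis by simp
    qed
  qed
  then show ?thesis
    by (intro measurable_restrict_space1 measurable_completion) simp
qed

lemma superlevel_left_continuous:
  assumes "0 < \<nu>" "0 < e"
  obtains \<mu> where "0 < \<mu>" "\<mu> < \<nu>" "measure lebesgue (A \<mu>) < measure lebesgue (A \<nu>) + e"
proof -
  \<comment> \<open>The shift by 2 keeps every level positive, where the superlevel sets have finite
    measure; a shift by 1 would start at level 0.\<close>
  define m where "m n = \<nu> - \<nu> / real (n + 2)" for n
  have m: "0 < m n" "m n < \<nu>" for n using assms by (auto simp: m_def field_simps add_pos_nonneg)
  have "(\<lambda>n. measure lebesgue (A (m n))) \<longlonglongrightarrow> measure lebesgue (\<Inter>n. A (m n))"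
  proof (rule Lim_measure_decseq)
    show "decseq (\<lambda>n. A (m n))"
      unfolding decseq_def
    proof (intro allI impI superlevel_antimono)
      fix i j :: nat assume "i \<le> j"
      then show "m i \<le> m j" using assms by (auto simp: m_def intro!: divide_left_mono)
    qed
    show "emeasure lebesgue (A (m i)) \<noteq> \<infinity>" for i using fin[OF m(1)[of i]] by auto
  qed auto
  moreover have "(\<Inter>n. A (m n)) = A \<nu>"
  proof
    show "A \<nu> \<subseteq> (\<Inter>n. A (m n))" using m superlevel_antimono by (meson INT_greatest less_imp_le)
    show "(\<Inter>n. A (m n)) \<subseteq> A \<nu>"
    proof
      fix x assume x: "x \<in> (\<Inter>n. A (m n))"
      have "(\<lambda>n. \<nu> - \<nu> / real n) \<longlonglongrightarrow> \<nu>"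
        by (auto intro!: tendsto_eq_intros lim_const_over_n)
      then have lim: "m \<longlonglongrightarrow> \<nu>"
        unfolding m_def by (rule LIMSEQ_ignore_initial_segment)
      have "\<nu> \<le> \<phi> x" using x by (intro LIMSEQ_le_const2[OF lim]) (auto simp: superlevel_def)
      then show "x \<in> A \<nu>" using x by (auto simp: superlevel_def)
    qed
  qed
  ultimately have "\<forall>\<^sub>F n in sequentially. measure lebesgue (A (m n)) < measure lebesgue (A \<nu>) + e"
    using order_tendstoD(2) assms(2) by fastforce
  then obtain n where "measure lebesgue (A (m n)) < measure lebesgue (A \<nu>) + e"
    by (auto simp: eventually_sequentially)
  then show thesis using that m by blast
qed

text \<open>As both families of sets decrease and have the same measures, left continuity of the measure of
  \<open>A \<nu>\<close> makes the intersection of the \<open>S \<mu>\<close>, \<open>\<mu> < \<nu>\<close>, equal to \<open>S \<nu>\<close> up to a null set.\<close>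

lemma negligible_superlevel_tamping:
  assumes "0 < \<nu>"
  shows "negligible (sym_diff (superlevel (tamping \<phi>) (ereal \<nu>)) (S \<nu>))"
proof -
  have sub: "S \<nu> \<subseteq> superlevel (tamping \<phi>) (ereal \<nu>)"
  proof
    fix x assume "x \<in> S \<nu>"
    then show "x \<in> superlevel (tamping \<phi>) (ereal \<nu>)"
      using tamp_set_nonneg[OF assms] tamp_set_antimono[of _ \<nu>]
      unfolding superlevel_def mem_Collect_eq le_tamping_iff[OF assms] by (auto dest: less_imp_le)
  qed
  have "negligible (superlevel (tamping \<phi>) (ereal \<nu>) - S \<nu>)"
    unfolding negligible_outer_le
  proof (intro allI impI)
    fix e :: real assume e: "0 < e"
    obtain \<mu> where \<mu>: "0 < \<mu>" "\<mu> < \<nu>" "measure lebesgue (A \<mu>) < measure lebesgue (A \<nu>) + e"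
      using superlevel_left_continuous[OF assms e] .
    have "superlevel (tamping \<phi>) (ereal \<nu>) \<subseteq> S \<mu>"
      using \<mu> by (auto simp: superlevel_def le_tamping_iff[OF assms])
    moreover have "measure lebesgue (S \<mu> - S \<nu>) = measure lebesgue (S \<mu>) - measure lebesgue (S \<nu>)"
      using tamp_set_lmeasurable[OF \<mu>(1)] tamp_set_lmeasurable[OF assms] tamp_set_antimono[OF \<mu>(1), of \<nu>] \<mu>
      by (intro measure_Diff) (auto dest: fmeasurableD fmeasurableD2 simp del: emeasure_completion)
    then have "measure lebesgue (S \<mu> - S \<nu>) \<le> e"
      using \<mu> assms by (simp add: measure_tamp_set)
    moreover have "S \<mu> - S \<nu> \<in> lmeasurable"
      using tamp_set_lmeasurable \<mu> assms by (intro fmeasurable_Diff fmeasurableD) auto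
    ultimately show "\<exists>T. superlevel (tamping \<phi>) (ereal \<nu>) - S \<nu> \<subseteq> T \<and> T \<in> lmeasurable \<and> measure lebesgue T \<le> e"
      by (intro exI[of _ "S \<mu> - S \<nu>"]) auto
  qed
  then show ?thesis using sub by (simp add: Diff_eq_empty_iff[THEN iffD2])
qed

text \<open>The points of infinite value lie in every \<open>S n\<close>. These sets have the
  measures of the \<open>A n\<close>, which tend to 0 because \<open>\<phi>\<close> is real valued
  and the \<open>A n\<close> have empty intersection.\<close>

lemma tamping_finite: "AE x in lebesgue_on {0..}. tamping \<phi> x \<noteq> \<infinity>"
proof -
  have "negligible {x \<in> {0..}. tamping \<phi> x = \<infinity>}"
    unfolding negligible_outer_le
  proof (intro allI impI)
    fix e :: real assume e: "0 < e"
    have "(\<lambda>n. measure lebesgue (A (real (Suc n)))) \<longlonglongrightarrow> measure lebesgue (\<Inter>n. A (real (Suc n)))"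
    proof (rule Lim_measure_decseq)
      show "decseq (\<lambda>n. A (real (Suc n)))"
        unfolding decseq_def by (intro allI impI superlevel_antimono) simp
      show "emeasure lebesgue (A (real (Suc i))) \<noteq> \<infinity>" for i
        using fin[of "real (Suc i)"] by auto
    qed auto
    moreover have "(\<Inter>n. A (real (Suc n))) = {}"
    proof -
      have "x \<notin> (\<Inter>n. A (real (Suc n)))" for x
      proof -
        obtain n where "\<phi> x < real n" using reals_Archimedean2 by blast
        then have "x \<notin> A (real (Suc n))" by (auto simp: superlevel_def)
        then show ?thesis by blast
      qed
      then show ?thesis by blast
    qed
    ultimately have "\<forall>\<^sub>F n in sequentially. measure lebesgue (A (real (Suc n))) < e"
      using order_tendstoD(2) e by fastforce
    then obtain n where n: "measure lebesgue (A (real (Suc n))) < e"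
      by (auto simp: eventually_sequentially)
    have "{x \<in> {0..}. tamping \<phi> x = \<infinity>} \<subseteq> S (real (Suc n))"
    proof
      fix x assume "x \<in> {x \<in> {0..}. tamping \<phi> x = \<infinity>}"
      \<comment> \<open>One level higher than the target, since \<open>le_tamping_iff\<close> gives
        membership only at strictly smaller levels.\<close>
      then have "ereal (real (Suc (Suc n))) \<le> tamping \<phi> x" by simp
      then show "x \<in> S (real (Suc n))"
        using le_tamping_iff[of "real (Suc (Suc n))" x] by auto
    qed
    then show "\<exists>T. {x \<in> {0..}. tamping \<phi> x = \<infinity>} \<subseteq> T \<and> T \<in> lmeasurable \<and> measure lebesgue T \<le> e"
      using n measure_tamp_set[of "real (Suc n)"] tamp_set_lmeasurable[of "real (Suc n)"]
      by (intro exI[of _ "S (real (Suc n))"]) auto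
  qed
  then have "AE x in lebesgue. x \<in> {0..} \<longrightarrow> tamping \<phi> x \<noteq> \<infinity>"
    unfolding negligible_iff_null_sets by (rule AE_I') auto
  then show ?thesis by (subst AE_restrict_space_iff) auto
qed

end

section \<open>Stability of the compressed positions and of the tamped sets\<close>

section \<open>Convergence of the sets\<close>

lemma emeasure_tendsto_0_iff:
  assumes "\<And>n. B n \<in> fmeasurable M"
  shows "(\<lambda>n. emeasure M (B n)) \<longlonglongrightarrow> 0 \<longleftrightarrow> (\<lambda>n. measure M (B n)) \<longlonglongrightarrow> 0"
  using tendsto_ennreal_iff[of "\<lambda>n. measure M (B n)" sequentially 0] assms
  by (simp add: emeasure_eq_measure2)

lemma measure_diff_le_sym_diff:
  assumes "A \<in> fmeasurable M" "B \<in> fmeasurable M"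
  shows "\<bar>measure M A - measure M B\<bar> \<le> measure M (sym_diff A B)"
proof -
  have *: "measure M U \<le> measure M V + measure M (sym_diff A B)"
    if "U \<in> fmeasurable M" "V \<in> fmeasurable M" "U - V \<subseteq> sym_diff A B" for U V
  proof -
    have "measure M U \<le> measure M (V \<union> sym_diff A B)"
      using assms that by (intro measure_mono_fmeasurable fmeasurable.Un fmeasurable_Diff fmeasurableD) auto
    also have "\<dots> \<le> measure M V + measure M (sym_diff A B)"
      using assms that by (intro measure_Un_le sets.Un sets.Diff fmeasurableD)
    finally show ?thesis .
  qed
  show ?thesis using *[of A B] *[of B A] assms by auto
qed

text \<open>A point in just one interval lies between the two left or between the two right end
  points; the right ones differ by at most |y' - y| + |m' - m|.\<close>

lemma measure_sym_diff_Icc_le: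
  fixes y m y' m' :: real
  assumes "0 \<le> m" "0 \<le> m'"
  shows "measure lebesgue (sym_diff {y'..y' + m'} {y..y + m}) \<le> 2 * \<bar>y' - y\<bar> + \<bar>m' - m\<bar>"
proof -
  let ?U = "{min y' y..max y' y}" and ?V = "{min (y' + m') (y + m)..max (y' + m') (y + m)}"
  have "measure lebesgue (sym_diff {y'..y' + m'} {y..y + m}) \<le> measure lebesgue (?U \<union> ?V)"
    by (intro measure_mono_fmeasurable fmeasurable.Un) auto
  also have "\<dots> \<le> measure lebesgue ?U + measure lebesgue ?V"
    by (intro measure_Un_le) auto
  also have "\<dots> \<le> 2 * \<bar>y' - y\<bar> + \<bar>m' - m\<bar>"
    by (auto simp: max_def min_def)
  finally show ?thesis .
qed

locale tampable_convergent = lim: tampable \<phi>\<^sub>0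
  for \<phi>\<^sub>0 :: "real \<Rightarrow> real" +
  fixes \<phi> :: "nat \<Rightarrow> real \<Rightarrow> real"
  assumes seq: "\<And>n. tampable (\<phi> n)"
    and hollows_conv: "\<And>a::real. 0 < a \<Longrightarrow>
      (\<lambda>n. emeasure lebesgue
             (sym_diff (hollows_below \<infinity> (\<phi> n)) (hollows_below \<infinity> \<phi>\<^sub>0) \<inter> {0..a})) \<longlonglongrightarrow> 0"
begin

sublocale seq: tampable "\<phi> n" for n by (rule seq)

text \<open>Complements in [0, a] have the same symmetric difference as the hollows. The case
  \<open>a = 0\<close> is separate because the hypothesis concerns positive
  \<open>a\<close>.\<close>

lemma solid_tendsto: 
  assumes "0 \<le> a"
  shows "(\<lambda>n. seq.solid n a) \<longlonglongrightarrow> lim.solid a"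
proof (cases "a = 0")
  case True
  have z: "measure lebesgue ({0..0} - B) = 0" for B :: "real set"
    by (rule negligible_imp_measure0, rule negligible_subset[of "{0}"]) auto
  show ?thesis unfolding True lim.solid_def seq.solid_def z by simp
next
  case False
  let ?D = "\<lambda>n. sym_diff (hollows_below \<infinity> (\<phi> n)) (hollows_below \<infinity> \<phi>\<^sub>0) \<inter> {0..a}"
  have "?D n \<in> lmeasurable" for n
    by (rule fmeasurableI2[of "{0..a}"]) auto
  then have D: "(\<lambda>n. measure lebesgue (?D n)) \<longlonglongrightarrow> 0"
    using hollows_conv[of a] assms False emeasure_tendsto_0_iff[of ?D lebesgue] by simp
  have "norm (seq.solid n a - lim.solid a) \<le> measure lebesgue (?D n)" for n
  proof -
    have "sym_diff ({0..a} - hollows_below \<infinity> (\<phi> n)) ({0..a} - hollows_below \<infinity> \<phi>\<^sub>0) = ?D n" by auto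
    then show ?thesis
      using measure_diff_le_sym_diff[OF seq.Icc_minus_hollows_lmeasurable[of 0 a n] lim.Icc_minus_hollows_lmeasurable[of 0 a]]
      by (simp add: seq.solid_def lim.solid_def)
  qed
  then have "(\<lambda>n. seq.solid n a - lim.solid a) \<longlonglongrightarrow> 0"
    by (intro Lim_null_comparison[OF _ D] always_eventually) auto
  then show ?thesis by (simp add: LIM_zero_iff)
qed

section \<open>One fixed level at which the superlevel sets converge\<close>

context
  fixes \<nu> :: real
  assumes \<nu>: "0 < \<nu>"
    and D: "(\<lambda>n. emeasure lebesgue (sym_diff (superlevel (\<phi> n) \<nu>) (superlevel \<phi>\<^sub>0 \<nu>))) \<longlonglongrightarrow> 0"
begin

lemma measure_superlevel_Int_tendsto:
  assumes Z: "Z \<in> sets lebesgue"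
  shows "(\<lambda>n. measure lebesgue (superlevel (\<phi> n) \<nu> \<inter> Z)) \<longlonglongrightarrow> measure lebesgue (superlevel \<phi>\<^sub>0 \<nu> \<inter> Z)"
proof -
  let ?D = "\<lambda>n. sym_diff (superlevel (\<phi> n) \<nu>) (superlevel \<phi>\<^sub>0 \<nu>)"
  have lm: "superlevel (\<phi> n) \<nu> \<in> lmeasurable" "superlevel \<phi>\<^sub>0 \<nu> \<in> lmeasurable" for n
    using \<nu> seq.superlevel_lmeasurable lim.superlevel_lmeasurable by auto
  then have lD: "?D n \<in> lmeasurable" for n
    by (intro fmeasurable.Un fmeasurable_Diff fmeasurableD)
  have D': "(\<lambda>n. measure lebesgue (?D n)) \<longlonglongrightarrow> 0"
    using D emeasure_tendsto_0_iff[of ?D lebesgue] lD by simp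
  have "norm (measure lebesgue (superlevel (\<phi> n) \<nu> \<inter> Z) - measure lebesgue (superlevel \<phi>\<^sub>0 \<nu> \<inter> Z))
      \<le> measure lebesgue (?D n)" for n
  proof -
    have "norm (measure lebesgue (superlevel (\<phi> n) \<nu> \<inter> Z) - measure lebesgue (superlevel \<phi>\<^sub>0 \<nu> \<inter> Z))
      \<le> measure lebesgue (sym_diff (superlevel (\<phi> n) \<nu> \<inter> Z) (superlevel \<phi>\<^sub>0 \<nu> \<inter> Z))"
      using measure_diff_le_sym_diff[OF fmeasurable_Int_fmeasurable[OF lm(1) Z] fmeasurable_Int_fmeasurable[OF lm(2) Z]]
      by simp
    also have "\<dots> \<le> measure lebesgue (?D n)"
      using Z by (intro measure_mono_fmeasurable lD sets.Un sets.Diff sets.Int) auto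
    finally show ?thesis .
  qed
  then have "(\<lambda>n. measure lebesgue (superlevel (\<phi> n) \<nu> \<inter> Z) - measure lebesgue (superlevel \<phi>\<^sub>0 \<nu> \<inter> Z)) \<longlonglongrightarrow> 0"
    by (intro Lim_null_comparison[OF _ D'] always_eventually) auto
  then show ?thesis by (simp add: LIM_zero_iff)
qed

text \<open>A positive limit of measures forces positive measures eventually. In this way the
  position of the limit set relative to a point passes to the sequence.\<close>

lemma eventually_not_negligible:
  assumes "Z \<in> sets lebesgue" "\<not> negligible (superlevel \<phi>\<^sub>0 \<nu> \<inter> Z)"
  shows "\<forall>\<^sub>F n in sequentially. \<not> negligible (superlevel (\<phi> n) \<nu> \<inter> Z)"
proof -
  have "superlevel \<phi>\<^sub>0 \<nu> \<inter> Z \<in> lmeasurable"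
    using \<nu> assms lim.superlevel_lmeasurable by (intro fmeasurable_Int_fmeasurable)
  then have "measure lebesgue (superlevel \<phi>\<^sub>0 \<nu> \<inter> Z) \<noteq> 0"
    using assms(2) by (simp add: negligible_iff_measure0)
  then have "0 < measure lebesgue (superlevel \<phi>\<^sub>0 \<nu> \<inter> Z)"
    by (simp add: zero_less_measure_iff)
  then have "\<forall>\<^sub>F n in sequentially. 0 < measure lebesgue (superlevel (\<phi> n) \<nu> \<inter> Z)"
    using order_tendstoD(1)[OF measure_superlevel_Int_tendsto[OF assms(1)]] by blast
  then show ?thesis
    by (rule eventually_mono) (metis less_irrefl negligible_imp_measure0)
qed

text \<open>A sliver of vanishing measure far to the left can keep
  \<open>tamp_x (\<phi> n) \<nu>\<close> away from its expected limit. The compressed positions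
  converge nevertheless, because everything between the sliver and the main part that does not
  belong to the superlevel set is hollow up to a null set.\<close>

lemma solid_tamp_x_tendsto:
  assumes nn: "\<not> negligible (superlevel \<phi>\<^sub>0 \<nu>)"
  shows "(\<lambda>n. seq.solid n (tamp_x (\<phi> n) \<nu>)) \<longlonglongrightarrow> lim.solid (tamp_x \<phi>\<^sub>0 \<nu>)"
proof -
  define x where "x = tamp_x \<phi>\<^sub>0 \<nu>"
  have x0: "0 \<le> x" unfolding x_def using nn by (rule lim.tamp_x_nonneg)
  have nn': "\<forall>\<^sub>F n in sequentially. \<not> negligible (superlevel (\<phi> n) \<nu>)"
    using eventually_not_negligible[of UNIV] nn by simp
  show ?thesis
    unfolding x_def[symmetric]
  proof (rule order_tendstoI)
    \<comment> \<open>Lower bound: \<open>solid_diff_le\<close> for \<open>\<phi> n\<close> at the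
      limit point \<open>x\<close>. The error is the mass of the superlevel set on [0, x], which
      tends to 0.\<close>
    fix l assume l: "l < lim.solid x"
    have "\<forall>\<^sub>F n in sequentially. \<not> negligible (superlevel (\<phi> n) \<nu> \<inter> {x..})"
      using lim.not_negligible_above_tamp_x[OF nn] by (intro eventually_not_negligible) (auto simp: x_def)
    moreover have "(\<lambda>n. seq.solid n x - measure lebesgue (superlevel (\<phi> n) \<nu> \<inter> {0..x}))
        \<longlonglongrightarrow> lim.solid x - measure lebesgue (superlevel \<phi>\<^sub>0 \<nu> \<inter> {0..x})"
      using x0 by (intro tendsto_diff solid_tendsto measure_superlevel_Int_tendsto) auto
    moreover have "measure lebesgue (superlevel \<phi>\<^sub>0 \<nu> \<inter> {0..x}) = 0"
    proof (rule negligible_imp_measure0, rule negligible_subset)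
      show "negligible (superlevel \<phi>\<^sub>0 \<nu> \<inter> {..x})"
        unfolding x_def using lim.negligible_below_tamp_x[OF nn] by simp
    qed auto
    ultimately have "\<forall>\<^sub>F n in sequentially. \<not> negligible (superlevel (\<phi> n) \<nu> \<inter> {x..})
        \<and> l < seq.solid n x - measure lebesgue (superlevel (\<phi> n) \<nu> \<inter> {0..x})"
      using l by (intro eventually_conj order_tendstoD(1)) auto
    then show "\<forall>\<^sub>F n in sequentially. l < seq.solid n (tamp_x (\<phi> n) \<nu>)"
    proof (rule eventually_mono)
      fix n assume "\<not> negligible (superlevel (\<phi> n) \<nu> \<inter> {x..})
        \<and> l < seq.solid n x - measure lebesgue (superlevel (\<phi> n) \<nu> \<inter> {0..x})"
      then show "l < seq.solid n (tamp_x (\<phi> n) \<nu>)"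
        using seq.solid_diff_le[of n \<nu> x] x0 by linarith
    qed
  next
    fix u assume u: "lim.solid x < u"
    \<comment> \<open>Upper bound: \<open>b\<close> lies beyond \<open>x\<close> by half the gap, so
      that the 1-Lipschitz \<open>solid\<close> stays below \<open>u\<close> at \<open>b\<close>.
      Eventually the essential infimum of the n-th superlevel set is at most
      \<open>b\<close>.\<close>
    define b where "b = x + (u - lim.solid x) / 2"
    have b: "x < b" "lim.solid b < u"
      using u lim.solid_lipschitz[OF x0, of b] by (auto simp: b_def field_simps)
    have "\<not> negligible (superlevel \<phi>\<^sub>0 \<nu> \<inter> {..b})"
      using lim.negligible_below_tamp_x[OF nn] b by (simp add: x_def)
    then have "\<forall>\<^sub>F n in sequentially. \<not> negligible (superlevel (\<phi> n) \<nu> \<inter> {..b})"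
      by (intro eventually_not_negligible) auto
    moreover have "\<forall>\<^sub>F n in sequentially. seq.solid n b < u"
      using x0 b by (intro order_tendstoD(2)[OF solid_tendsto]) auto
    ultimately show "\<forall>\<^sub>F n in sequentially. seq.solid n (tamp_x (\<phi> n) \<nu>) < u"
      using nn'
    proof eventually_elim
      case (elim n)
      then have "tamp_x (\<phi> n) \<nu> \<le> b" using seq.negligible_below_tamp_x[of n \<nu> b] by simp
      then show ?case using seq.solid_mono[of "tamp_x (\<phi> n) \<nu>" b n] seq.tamp_x_nonneg[of n \<nu>] elim by simp
    qed
  qed
qed

text \<open>If the limit set is null, the symmetric difference is the n-th tamped set, whose measure
  is that of the superlevel set and tends to 0. Otherwise both are eventually intervals whose left
  end points and lengths converge.\<close>

lemma tamp_set_tendsto: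
  "(\<lambda>n. emeasure lebesgue (sym_diff (tamp_set (\<phi> n) \<nu>) (tamp_set \<phi>\<^sub>0 \<nu>))) \<longlonglongrightarrow> 0"
proof -
  have lm: "sym_diff (tamp_set (\<phi> n) \<nu>) (tamp_set \<phi>\<^sub>0 \<nu>) \<in> lmeasurable" for n
    using seq.tamp_set_lmeasurable[OF \<nu>] lim.tamp_set_lmeasurable[OF \<nu>]
    by (intro fmeasurable.Un fmeasurable_Diff fmeasurableD)
  have m: "(\<lambda>n. measure lebesgue (superlevel (\<phi> n) \<nu>)) \<longlonglongrightarrow> measure lebesgue (superlevel \<phi>\<^sub>0 \<nu>)"
    using measure_superlevel_Int_tendsto[of UNIV] by simp
  have "(\<lambda>n. measure lebesgue (sym_diff (tamp_set (\<phi> n) \<nu>) (tamp_set \<phi>\<^sub>0 \<nu>))) \<longlonglongrightarrow> 0"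
  proof (cases "negligible (superlevel \<phi>\<^sub>0 \<nu>)")
    case True
    then show ?thesis
      using m seq.measure_tamp_set[OF \<nu>] lim.tamp_set_eq[OF \<nu>] negligible_imp_measure0[OF True] by simp
  next
    case False
    let ?b = "\<lambda>n. 2 * \<bar>seq.solid n (tamp_x (\<phi> n) \<nu>) - lim.solid (tamp_x \<phi>\<^sub>0 \<nu>)\<bar>
      + \<bar>measure lebesgue (superlevel (\<phi> n) \<nu>) - measure lebesgue (superlevel \<phi>\<^sub>0 \<nu>)\<bar>"
    have "?b \<longlonglongrightarrow> 2 * \<bar>lim.solid (tamp_x \<phi>\<^sub>0 \<nu>) - lim.solid (tamp_x \<phi>\<^sub>0 \<nu>)\<bar>
      + \<bar>measure lebesgue (superlevel \<phi>\<^sub>0 \<nu>) - measure lebesgue (superlevel \<phi>\<^sub>0 \<nu>)\<bar>"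
      by (intro tendsto_intros m solid_tamp_x_tendsto False)
    then have b: "?b \<longlonglongrightarrow> 0" by simp
    have "\<forall>\<^sub>F n in sequentially. \<not> negligible (superlevel (\<phi> n) \<nu>)"
      using eventually_not_negligible[of UNIV] False by simp
    then have "\<forall>\<^sub>F n in sequentially. norm (measure lebesgue (sym_diff (tamp_set (\<phi> n) \<nu>) (tamp_set \<phi>\<^sub>0 \<nu>))) \<le> ?b n"
    proof (rule eventually_mono)
      fix n assume "\<not> negligible (superlevel (\<phi> n) \<nu>)"
      then show "norm (measure lebesgue (sym_diff (tamp_set (\<phi> n) \<nu>) (tamp_set \<phi>\<^sub>0 \<nu>))) \<le> ?b n"
        using False seq.tamp_set_eq[OF \<nu>] lim.tamp_set_eq[OF \<nu>] measure_sym_diff_Icc_le by simp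
    qed
    then show ?thesis using b by (rule Lim_null_comparison)
  qed
  then show ?thesis using emeasure_tendsto_0_iff[OF lm] by simp
qed

end

end

section \<open>L^p norms as integrals, convergence tools and layer weights\<close>

section \<open>Convergence in \<open>L\<^sup>p\<close>\<close>

lemma ennreal_rpow_ennreal: "0 \<le> a \<Longrightarrow> ennreal_rpow (ennreal a) r = ennreal (a powr r)"
  by (simp add: ennreal_rpow_def)

lemma ennreal_rpow_less_top_iff: "ennreal_rpow a r < \<infinity> \<longleftrightarrow> a < \<infinity>"
  by (auto simp: ennreal_rpow_def less_top)

lemma ennreal_rpow_inverse:
  assumes "0 < r"
  shows "ennreal_rpow (ennreal_rpow a (1 / r)) r = a"
  using assms by (cases a) (auto simp: ennreal_rpow_ennreal powr_powr, simp add: ennreal_rpow_def)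

lemma ennreal_rpow_tendsto_0:
  assumes a: "a \<longlonglongrightarrow> 0" and r: "0 < r"
  shows "(\<lambda>n. ennreal_rpow (a n) r) \<longlonglongrightarrow> 0"
proof -
  have "(\<lambda>n. enn2real (a n)) \<longlonglongrightarrow> 0"
    using a by (intro tendsto_enn2real) auto
  then have "(\<lambda>n. enn2real (a n) powr r) \<longlonglongrightarrow> 0"
    by (rule tendsto_zero_powrI) (use r in \<open>auto intro: tendsto_const\<close>)
  then have "(\<lambda>n. ennreal (enn2real (a n) powr r)) \<longlonglongrightarrow> 0"
    using tendsto_ennrealI by fastforce
  moreover have "\<forall>\<^sub>F n in sequentially. a n < 1"
    using a by (rule order_tendstoD) simp
  then have "\<forall>\<^sub>F n in sequentially. ennreal (enn2real (a n) powr r) = ennreal_rpow (a n) r"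
    by (rule eventually_mono) (auto simp: ennreal_rpow_def)
  ultimately show ?thesis by (rule Lim_transform_eventually)
qed

lemma Lp_norm_real:
  assumes "AE x in lebesgue_on {0..}. f x = ereal (g x)"
  shows "Lp_norm p f = ennreal_rpow (\<integral>\<^sup>+x. ennreal (\<bar>g x\<bar> powr p) \<partial>lebesgue_on {0..}) (1 / p)"
proof -
  have "(\<integral>\<^sup>+x. ennreal_rpow (e2ennreal \<bar>f x\<bar>) p \<partial>lebesgue_on {0..})
      = (\<integral>\<^sup>+x. ennreal (\<bar>g x\<bar> powr p) \<partial>lebesgue_on {0..})"
    by (rule nn_integral_cong_AE, use assms in eventually_elim) (simp add: ennreal_rpow_ennreal)
  then show ?thesis by (simp add: Lp_norm_def)
qed

text \<open>Passes to real representatives and removes the p-th root, which preserves finiteness and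
  convergence to 0 in both directions.\<close>

lemma Lp_tendsto_real_iff:
  assumes p: "0 < p"
    and f: "\<And>n. f n \<in> borel_measurable (lebesgue_on {0..})" "\<And>n. AE x in lebesgue_on {0..}. f n x = ereal (g n x)"
    and f\<^sub>0: "f\<^sub>0 \<in> borel_measurable (lebesgue_on {0..})" "AE x in lebesgue_on {0..}. f\<^sub>0 x = ereal (g\<^sub>0 x)"
  shows "Lp_tendsto p f f\<^sub>0 \<longleftrightarrow>
    (\<forall>n. (\<integral>\<^sup>+x. ennreal (\<bar>g n x\<bar> powr p) \<partial>lebesgue_on {0..}) < \<infinity>) \<and>
    (\<integral>\<^sup>+x. ennreal (\<bar>g\<^sub>0 x\<bar> powr p) \<partial>lebesgue_on {0..}) < \<infinity> \<and>
    (\<lambda>n. \<integral>\<^sup>+x. ennreal (\<bar>g n x - g\<^sub>0 x\<bar> powr p) \<partial>lebesgue_on {0..}) \<longlonglongrightarrow> 0"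
proof -
  have diff: "AE x in lebesgue_on {0..}. f n x - f\<^sub>0 x = ereal (g n x - g\<^sub>0 x)" for n
    using f(2)[of n] f\<^sub>0(2) by eventually_elim simp
  let ?I = "\<lambda>n. \<integral>\<^sup>+x. ennreal (\<bar>g n x - g\<^sub>0 x\<bar> powr p) \<partial>lebesgue_on {0..}"
  have "(\<lambda>n. ennreal_rpow (?I n) (1 / p)) \<longlonglongrightarrow> 0 \<longleftrightarrow> ?I \<longlonglongrightarrow> 0"
  proof
    assume "(\<lambda>n. ennreal_rpow (?I n) (1 / p)) \<longlonglongrightarrow> 0"
    from ennreal_rpow_tendsto_0[OF this p] show "?I \<longlonglongrightarrow> 0"
      by (simp add: ennreal_rpow_inverse[OF p])
  next
    assume "?I \<longlonglongrightarrow> 0"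
    then show "(\<lambda>n. ennreal_rpow (?I n) (1 / p)) \<longlonglongrightarrow> 0"
      using p by (intro ennreal_rpow_tendsto_0) auto
  qed
  then show ?thesis
    unfolding Lp_tendsto_def in_Lp_def Lp_norm_real[OF f(2)] Lp_norm_real[OF f\<^sub>0(2)] Lp_norm_real[OF diff]
    using f(1) f\<^sub>0(1) by (simp add: ennreal_rpow_less_top_iff del: infinity_ennreal_def)
qed

text \<open>Integration of \<open>abs_powr_diff_le\<close> bounds the distance by a small multiple
  of the fixed integral \<open>K\<close> plus a large multiple of a vanishing one: first
  \<open>t\<close> is chosen, then n.\<close>

lemma powr_tendsto_L1:
  fixes f :: "nat \<Rightarrow> 'a \<Rightarrow> real"
  assumes p: "1 \<le> p"
    and f[measurable]: "\<And>n. f n \<in> borel_measurable M" "f\<^sub>0 \<in> borel_measurable M"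
    and nn: "\<And>n. AE x in M. 0 \<le> f n x" "AE x in M. 0 \<le> f\<^sub>0 x"
    and fin: "(\<integral>\<^sup>+x. ennreal (\<bar>f\<^sub>0 x\<bar> powr p) \<partial>M) < \<infinity>"
    and lim: "(\<lambda>n. \<integral>\<^sup>+x. ennreal (\<bar>f n x - f\<^sub>0 x\<bar> powr p) \<partial>M) \<longlonglongrightarrow> 0"
  shows "(\<lambda>n. \<integral>\<^sup>+x. ennreal \<bar>f n x powr p - f\<^sub>0 x powr p\<bar> \<partial>M) \<longlonglongrightarrow> 0"
proof -
  let ?I = "\<lambda>n. \<integral>\<^sup>+x. ennreal (\<bar>f n x - f\<^sub>0 x\<bar> powr p) \<partial>M"
  let ?J = "\<lambda>n. \<integral>\<^sup>+x. ennreal \<bar>f n x powr p - f\<^sub>0 x powr p\<bar> \<partial>M"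
  define K where "K = enn2real (\<integral>\<^sup>+x. ennreal (\<bar>f\<^sub>0 x\<bar> powr p) \<partial>M)"
  have K: "(\<integral>\<^sup>+x. ennreal (\<bar>f\<^sub>0 x\<bar> powr p) \<partial>M) = ennreal K" "0 \<le> K"
    using fin by (auto simp: K_def)
  define c where "c t = (1 - t) powr (1 - p) - 1" for t :: real
  have bound: "?J n \<le> ennreal (c t * K) + ennreal (t powr (1 - p)) * ?I n" if t: "0 < t" "t < 1" for n t
  proof -
    have c: "0 \<le> c t" using p t powr_mono2'[of "1 - p" "1 - t" 1] by (simp add: c_def)
    have "?J n \<le> (\<integral>\<^sup>+x. ennreal (c t) * ennreal (\<bar>f\<^sub>0 x\<bar> powr p) + ennreal (t powr (1 - p)) * ennreal (\<bar>f n x - f\<^sub>0 x\<bar> powr p) \<partial>M)"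
    proof (rule nn_integral_mono_AE, use nn(1)[of n] nn(2) in eventually_elim)
      case (elim x)
      then show ?case
        using abs_powr_diff_le[OF p t, of "f n x" "f\<^sub>0 x"] c
        by (simp add: c_def ennreal_mult[symmetric] ennreal_plus[symmetric] ennreal_leI del: ennreal_plus)
    qed
    also have "\<dots> = ennreal (c t) * ennreal K + ennreal (t powr (1 - p)) * ?I n"
      by (simp add: nn_integral_add nn_integral_cmult K)
    finally show ?thesis using c K by (simp add: ennreal_mult)
  qed
  show ?thesis
  proof (rule order_tendstoI)
    fix e :: ennreal assume "0 < e"
    then obtain e' where e': "0 < e'" "ennreal e' < e"
      by (metis dense ennreal_cases ennreal_less_zero_iff infinity_ennreal_def not_less_iff_gr_or_eq top.extremum_strict)
    \<comment> \<open>(1 - t)^(1 - p) tends to 1 as t decreases to 0, so the coefficient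
      \<open>c t\<close> tends to 0.\<close>
    have "((\<lambda>t. c t * K) \<longlongrightarrow> ((1 - 0) powr (1 - p) - 1) * K) (at_right 0)"
      unfolding c_def by (intro tendsto_intros) auto
    then have "\<forall>\<^sub>F t in at_right 0. c t * K < e' / 2"
      using e' by (intro order_tendstoD(2)) auto
    moreover have "\<forall>\<^sub>F t in at_right (0::real). t \<in> {0<..<1}"
      by (rule eventually_at_right_real) simp
    ultimately have "\<forall>\<^sub>F t in at_right 0. c t * K < e' / 2 \<and> t \<in> {0<..<1}"
      by (rule eventually_conj)
    then obtain t where t: "c t * K < e' / 2" "0 < t" "t < 1"
      using eventually_happens'[OF trivial_limit_at_right_real] by fastforce
    have "(\<lambda>n. ennreal (t powr (1 - p)) * ?I n) \<longlonglongrightarrow> ennreal (t powr (1 - p)) * 0"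
      by (intro ennreal_tendsto_cmult lim) simp
    then have "\<forall>\<^sub>F n in sequentially. ennreal (t powr (1 - p)) * ?I n < ennreal (e' / 2)"
      using e' by (intro order_tendstoD(2)) auto
    then show "\<forall>\<^sub>F n in sequentially. ?J n < e"
    proof (rule eventually_mono)
      fix n assume n: "ennreal (t powr (1 - p)) * ?I n < ennreal (e' / 2)"
      have "?J n \<le> ennreal (c t * K) + ennreal (t powr (1 - p)) * ?I n" by (rule bound[OF t(2,3)])
      also have "\<dots> \<le> ennreal (e' / 2) + ennreal (e' / 2)"
        using n t by (intro add_mono ennreal_leI less_imp_le) auto
      also have "\<dots> = ennreal e'" using e' by (simp add: ennreal_plus[symmetric] del: ennreal_plus)
      finally show "?J n < e" using e' by simp
    qed
  qed simp
qed

text \<open>The L^1 subsequence theorem for real functions, transferred to extended values.\<close>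

lemma nn_integral_tendsto_0_AE_subseq:
  fixes w :: "nat \<Rightarrow> 'a \<Rightarrow> ennreal"
  assumes [measurable]: "\<And>n. w n \<in> borel_measurable M"
    and lim: "(\<lambda>n. integral\<^sup>N M (w n)) \<longlonglongrightarrow> 0"
  shows "\<exists>r::nat \<Rightarrow> nat. strict_mono r \<and> (AE x in M. (\<lambda>n. w (r n) x) \<longlonglongrightarrow> 0)"
proof -
  have "\<forall>\<^sub>F n in sequentially. integral\<^sup>N M (w n) < 1"
    using lim by (rule order_tendstoD) simp
  \<comment> \<open>Early terms may have infinite integral; from \<open>N\<close> on the integrals
    are below 1 and the functions finite almost everywhere.\<close>
  then obtain N where N: "\<And>n. N \<le> n \<Longrightarrow> integral\<^sup>N M (w n) < 1"
    by (auto simp: eventually_sequentially)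
  define u where "u n x = enn2real (w (n + N) x)" for n x
  have fin: "AE x in M. w (n + N) x \<noteq> \<infinity>" for n
    using N[of "n + N"] by (intro nn_integral_noteq_infinite) (auto simp: less_top[symmetric] top_unique)
  have eq: "AE x in M. ennreal (u n x) = w (n + N) x" for n
    using fin[of n] by (rule eventually_mono) (simp add: u_def less_top)
  then have int: "(\<integral>\<^sup>+x. ennreal (u n x) \<partial>M) = integral\<^sup>N M (w (n + N))" for n
    by (intro nn_integral_cong_AE) auto
  have um[measurable]: "u n \<in> borel_measurable M" for n unfolding u_def by measurable
  have "integrable M (u n)" for n
  proof (rule integrableI_nonneg)
    show "AE x in M. 0 \<le> u n x" by (simp add: u_def)
    show "(\<integral>\<^sup>+x. ennreal (u n x) \<partial>M) < \<infinity>"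
      unfolding int using N[of "n + N"] by (auto intro: less_trans)
  qed measurable
  moreover have "(\<integral>x. norm (u n x) \<partial>M) = enn2real (integral\<^sup>N M (w (n + N)))" for n
    unfolding int[symmetric] by (subst integral_eq_nn_integral) (auto simp: u_def)
  moreover have "(\<lambda>n. enn2real (integral\<^sup>N M (w (n + N)))) \<longlonglongrightarrow> 0"
    using LIMSEQ_ignore_initial_segment[OF lim, of N] by (intro tendsto_enn2real) auto
  ultimately obtain r where r: "strict_mono r" "AE x in M. (\<lambda>n. u (r n) x) \<longlonglongrightarrow> 0"
    using tendsto_L1_AE_subseq[of M u] by auto
  have "AE x in M. \<forall>n. ennreal (u n x) = w (n + N) x"
    using eq by (simp add: AE_all_countable)
  with r(2) have "AE x in M. (\<lambda>n. w (r n + N) x) \<longlonglongrightarrow> 0"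
  proof eventually_elim
    case (elim x)
    have "(\<lambda>n. ennreal (u (r n) x)) \<longlonglongrightarrow> ennreal 0" using elim(1) by (rule tendsto_ennrealI)
    then show ?case using elim(2) by simp
  qed
  moreover have "strict_mono (\<lambda>n. r n + N)" using r(1) by (simp add: strict_mono_def)
  ultimately show ?thesis by blast
qed

text \<open>From v \<le> a + d follows v \<le> min v a + d. The minimum is dominated by the
  integrable \<open>a\<close>, and the integrals of \<open>d\<close> vanish in the limit.\<close>

lemma nn_integral_dominated_convergence_perturbed:
  fixes v w d :: "_ \<Rightarrow> _ \<Rightarrow> ennreal"
  assumes [measurable]: "\<And>n. v n \<in> borel_measurable M" "a \<in> borel_measurable M" "\<And>n. d n \<in> borel_measurable M"
    and a: "integral\<^sup>N M a < \<infinity>" and d: "(\<lambda>n. integral\<^sup>N M (d n)) \<longlonglongrightarrow> 0"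
    and bound: "\<And>n. AE x in M. v n x \<le> a x + d n x"
    and v: "AE x in M. (\<lambda>n. v n x) \<longlonglongrightarrow> 0"
  shows "(\<lambda>n. integral\<^sup>N M (v n)) \<longlonglongrightarrow> 0"
proof (rule tendsto_sandwich[OF _ _ tendsto_const])
  have "(\<lambda>n. \<integral>\<^sup>+x. min (v n x) (a x) \<partial>M) \<longlonglongrightarrow> (\<integral>\<^sup>+x. 0 \<partial>M)"
  proof (rule nn_integral_dominated_convergence[where w = a])
    show "AE x in M. (\<lambda>n. min (v n x) (a x)) \<longlonglongrightarrow> 0"
      using v
    proof eventually_elim
      case (elim x)
      show ?case by (rule tendsto_sandwich[OF _ _ tendsto_const elim]) auto
    qed
  qed (use a in auto)
  then show "(\<lambda>n. (\<integral>\<^sup>+x. min (v n x) (a x) \<partial>M) + integral\<^sup>N M (d n)) \<longlonglongrightarrow> 0"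
    using tendsto_add[OF _ d] by fastforce
  show "\<forall>\<^sub>F n in sequentially. integral\<^sup>N M (v n) \<le> (\<integral>\<^sup>+x. min (v n x) (a x) \<partial>M) + integral\<^sup>N M (d n)"
  proof (rule always_eventually, rule allI)
    fix n
    have "integral\<^sup>N M (v n) \<le> (\<integral>\<^sup>+x. min (v n x) (a x) + d n x \<partial>M)"
      by (rule nn_integral_mono_AE, use bound[of n] in eventually_elim)
        (auto simp: min_def intro: add_increasing2)
    also have "\<dots> = (\<integral>\<^sup>+x. min (v n x) (a x) \<partial>M) + integral\<^sup>N M (d n)"
      by (rule nn_integral_add) auto
    finally show "integral\<^sup>N M (v n) \<le> (\<integral>\<^sup>+x. min (v n x) (a x) \<partial>M) + integral\<^sup>N M (d n)" .
  qed
qed simp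

text \<open>Finite superlevel measures come from Markov's inequality at height \<nu>, applied to the
  p-th power.\<close>

lemma tampable_if_in_Lp:
  assumes p: "0 < p" and f: "in_Lp p (\<lambda>x. ereal (\<phi> x))"
  shows "tampable \<phi>"
proof
  have "(\<lambda>x. real_of_ereal (ereal (\<phi> x))) \<in> borel_measurable (lebesgue_on {0..})"
    using f unfolding in_Lp_def by (intro borel_measurable_real_of_ereal) auto
  then show m: "\<phi> \<in> borel_measurable (lebesgue_on {0..})" by simp
  have I: "(\<integral>\<^sup>+x. ennreal (\<bar>\<phi> x\<bar> powr p) \<partial>lebesgue_on {0..}) < \<infinity>"
    using f Lp_norm_real[of "\<lambda>x. ereal (\<phi> x)" \<phi> p]
    by (simp add: in_Lp_def ennreal_rpow_less_top_iff del: infinity_ennreal_def)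
  fix \<nu> :: real assume \<nu>: "0 < \<nu>"
  have S: "superlevel \<phi> \<nu> = {x \<in> space (lebesgue_on {0..}). \<nu> \<le> \<phi> x}" by (auto simp: superlevel_def)
  have meas: "superlevel \<phi> \<nu> \<in> sets (lebesgue_on {0..})" unfolding S using m by measurable
  have "ennreal (\<nu> powr p) * emeasure (lebesgue_on {0..}) (superlevel \<phi> \<nu>)
      = (\<integral>\<^sup>+x. ennreal (\<nu> powr p) * indicator (superlevel \<phi> \<nu>) x \<partial>lebesgue_on {0..})"
    using meas by (simp add: nn_integral_cmult_indicator)
  also have "\<dots> \<le> (\<integral>\<^sup>+x. ennreal (\<bar>\<phi> x\<bar> powr p) \<partial>lebesgue_on {0..})"
    using \<nu> p by (intro nn_integral_mono) (auto simp: indicator_def superlevel_def intro!: ennreal_leI powr_mono2)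
  also note I
  finally have "emeasure (lebesgue_on {0..}) (superlevel \<phi> \<nu>) < \<infinity>"
    using \<nu> by (auto simp: ennreal_mult_less_top)
  then show "emeasure lebesgue (superlevel \<phi> \<nu>) < \<infinity>"
    by (subst (asm) emeasure_restrict_space) (auto simp: superlevel_def)
qed

text \<open>Level 0 is a single point, so it may be dropped; this matches the positive levels of the
  layer cake integral.\<close>

lemma AE_half_line_iff:
  "(AE \<nu> in lebesgue_on {0::real..}. P \<nu>) \<longleftrightarrow> (AE \<nu> in lborel. 0 < \<nu> \<longrightarrow> P \<nu>)"
proof -
  have "(AE \<nu> in lebesgue_on {0::real..}. P \<nu>) \<longleftrightarrow> (AE \<nu> in lborel. \<nu> \<in> {0..} \<longrightarrow> P \<nu>)"
    by (subst AE_restrict_space_iff) (auto simp: AE_completion_iff)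
  also have "\<dots> \<longleftrightarrow> (AE \<nu> in lborel. 0 < \<nu> \<longrightarrow> P \<nu>)"
    by (rule eventually_cong[OF AE_lborel_singleton[of 0]]) auto
  finally show ?thesis .
qed

text \<open>The integrand of the layer cake formula on the half-line. With \<open>g = 0\<close> its
  integral is the p-th power of the L^p norm of a nonnegative \<open>f\<close>.\<close>

definition level_weight :: "real \<Rightarrow> (real \<Rightarrow> real) \<Rightarrow> (real \<Rightarrow> real) \<Rightarrow> real \<Rightarrow> ennreal" where
  "level_weight p f g \<nu> = ennreal (p * \<nu> powr (p - 1)) *
     emeasure lebesgue (sym_diff (superlevel f \<nu>) (superlevel g \<nu>)) * indicator {0<..} \<nu>"

lemma emeasure_sym_diff_levels:
  "emeasure (lebesgue_on {0..}) (sym_diff {x \<in> space (lebesgue_on {0..}). \<nu> \<le> f x} {x \<in> space (lebesgue_on {0..}). \<nu> \<le> g x})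
    = emeasure lebesgue (sym_diff (superlevel f \<nu>) (superlevel g \<nu>))"
  by (subst emeasure_restrict_space) (auto simp: superlevel_def)

lemma level_weight_measurable:
  assumes "f \<in> borel_measurable (lebesgue_on {0..})" "g \<in> borel_measurable (lebesgue_on {0..})"
  shows "level_weight p f g \<in> borel_measurable lborel"
proof -
  have [measurable]: "(\<lambda>\<nu>. emeasure lebesgue (sym_diff (superlevel f \<nu>) (superlevel g \<nu>))) \<in> borel_measurable borel"
    using borel_measurable_emeasure_sym_diff_levels[OF sigma_finite_lebesgue_on_half assms]
    unfolding emeasure_sym_diff_levels .
  show ?thesis unfolding level_weight_def[abs_def] by measurable
qed

lemma nn_integral_level_weight:
  assumes "1 \<le> p" "f \<in> borel_measurable (lebesgue_on {0..})" "g \<in> borel_measurable (lebesgue_on {0..})"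
    "AE x in lebesgue_on {0..}. 0 \<le> f x" "AE x in lebesgue_on {0..}. 0 \<le> g x"
  shows "integral\<^sup>N lborel (level_weight p f g) = (\<integral>\<^sup>+x. ennreal \<bar>f x powr p - g x powr p\<bar> \<partial>lebesgue_on {0..})"
  unfolding layer_cake_diff[OF sigma_finite_lebesgue_on_half assms] emeasure_sym_diff_levels
    level_weight_def[abs_def] ..

lemma nn_integral_level_weight_0:
  assumes "1 \<le> p" "f \<in> borel_measurable (lebesgue_on {0..})" "AE x in lebesgue_on {0..}. 0 \<le> f x"
  shows "integral\<^sup>N lborel (level_weight p f (\<lambda>_. 0)) = (\<integral>\<^sup>+x. ennreal (\<bar>f x\<bar> powr p) \<partial>lebesgue_on {0..})"
proof -
  have "(\<integral>\<^sup>+x. ennreal \<bar>f x powr p - 0 powr p\<bar> \<partial>lebesgue_on {0..})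
      = (\<integral>\<^sup>+x. ennreal (\<bar>f x\<bar> powr p) \<partial>lebesgue_on {0..})"
    by (rule nn_integral_cong_AE, use assms(3) in eventually_elim) simp
  then show ?thesis using nn_integral_level_weight[of p f "\<lambda>_. 0"] assms by simp
qed

lemma emeasure_sym_diff_cong_AE:
  assumes "A \<in> sets lebesgue" "A' \<in> sets lebesgue" "B \<in> sets lebesgue" "B' \<in> sets lebesgue"
    and AA: "AE x in lebesgue. x \<in> A \<longleftrightarrow> x \<in> A'" and BB: "AE x in lebesgue. x \<in> B \<longleftrightarrow> x \<in> B'"
  shows "emeasure lebesgue (sym_diff A B) = emeasure lebesgue (sym_diff A' B')"
proof (rule emeasure_eq_AE)
  show "AE x in lebesgue. x \<in> sym_diff A B \<longleftrightarrow> x \<in> sym_diff A' B'"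
    using AA BB by eventually_elim auto
qed (use assms in auto)

lemma negligible_sym_diff_AE: "negligible (sym_diff A B) \<Longrightarrow> AE x in lebesgue. x \<in> A \<longleftrightarrow> x \<in> B"
  unfolding negligible_iff_null_sets by (rule AE_I') auto

section \<open>A real-valued representative of the tamping and its norm\<close>

context tampable
begin

text \<open>Infinite values become 0; they occur on a null set only.\<close>

definition tamping_real :: "real \<Rightarrow> real" where
  "tamping_real x = real_of_ereal (tamping \<phi> x)"

lemma tamping_real_measurable: "tamping_real \<in> borel_measurable (lebesgue_on {0..})"
  unfolding tamping_real_def[abs_def] using tamping_measurable by (rule borel_measurable_real_of_ereal)

lemma tamping_real_nonneg: "0 \<le> tamping_real x"
  by (simp add: tamping_real_def tamping_nonneg real_of_ereal_pos)

lemma tamping_eq_real: "AE x in lebesgue_on {0..}. tamping \<phi> x = ereal (tamping_real x)"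
  using tamping_finite
proof eventually_elim
  case (elim x)
  then show ?case using tamping_nonneg[of x] by (cases "tamping \<phi> x") (auto simp: tamping_real_def)
qed

lemma superlevel_tamping_AE:
  assumes "0 < \<nu>"
  shows "AE x in lebesgue. x \<in> superlevel (tamping \<phi>) (ereal \<nu>) \<longleftrightarrow> x \<in> S \<nu>"
  using negligible_superlevel_tamping[OF assms] by (rule negligible_sym_diff_AE)

lemma superlevel_tamping_real_AE:
  assumes "0 < \<nu>"
  shows "AE x in lebesgue. x \<in> superlevel tamping_real \<nu> \<longleftrightarrow> x \<in> S \<nu>"
proof -
  have "AE x in lebesgue. x \<in> {0..} \<longrightarrow> tamping \<phi> x = ereal (tamping_real x)"
    using tamping_eq_real by (subst (asm) AE_restrict_space_iff) auto
  then show ?thesis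
    using superlevel_tamping_AE[OF assms]
    by eventually_elim (auto simp: superlevel_def)
qed

lemma tamp_set_sets: "0 < \<nu> \<Longrightarrow> S \<nu> \<in> sets lebesgue"
  using tamp_set_lmeasurable by (rule fmeasurableD)

lemma emeasure_tamp_set: "0 < \<nu> \<Longrightarrow> emeasure lebesgue (S \<nu>) = emeasure lebesgue (A \<nu>)"
  using measure_tamp_set[of \<nu>] tamp_set_lmeasurable[of \<nu>] superlevel_lmeasurable[of \<nu>]
  by (simp only: emeasure_eq_measure2)

text \<open>Tamping preserves the measure of each superlevel set at positive height, so the layer
  cake integrals against 0 agree.\<close>

lemma nn_integral_tamping_real:
  assumes p: "1 \<le> p" and nn: "AE x in lebesgue_on {0..}. 0 \<le> \<phi> x"
  shows "(\<integral>\<^sup>+x. ennreal (\<bar>tamping_real x\<bar> powr p) \<partial>lebesgue_on {0..})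
    = (\<integral>\<^sup>+x. ennreal (\<bar>\<phi> x\<bar> powr p) \<partial>lebesgue_on {0..})"
proof -
  have "level_weight p tamping_real (\<lambda>_. 0) \<nu> = level_weight p \<phi> (\<lambda>_. 0) \<nu>" for \<nu>
  proof (cases "0 < \<nu>")
    case True
    then have "superlevel (\<lambda>_. 0) \<nu> = {}" by (auto simp: superlevel_def)
    moreover have "emeasure lebesgue (superlevel tamping_real \<nu>) = emeasure lebesgue (S \<nu>)"
      using True by (intro emeasure_eq_AE superlevel_tamping_real_AE sets_superlevel tamping_real_measurable tamp_set_sets)
    ultimately show ?thesis
      using emeasure_tamp_set[OF True] by (simp add: level_weight_def del: emeasure_completion)
  qed (simp add: level_weight_def)
  then have "integral\<^sup>N lborel (level_weight p tamping_real (\<lambda>_. 0)) = integral\<^sup>N lborel (level_weight p \<phi> (\<lambda>_. 0))"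
    by (intro nn_integral_cong) simp
  then show ?thesis
    using nn_integral_level_weight_0[OF p meas nn]
      nn_integral_level_weight_0[OF p tamping_real_measurable] tamping_real_nonneg by simp
qed

end

section \<open>Convergence of the tampings in L^p\<close>

locale Lp_tampable_convergent =
  fixes p :: real and \<phi> :: "nat \<Rightarrow> real \<Rightarrow> real" and \<phi>\<^sub>0 :: "real \<Rightarrow> real"
  assumes p: "1 \<le> p"
    and nonneg: "\<And>n. AE x in lebesgue_on {0..}. 0 \<le> \<phi> n x"
    and nonneg0: "AE x in lebesgue_on {0..}. 0 \<le> \<phi>\<^sub>0 x"
    and conv: "Lp_tendsto p (\<lambda>n x. ereal (\<phi> n x)) (\<lambda>x. ereal (\<phi>\<^sub>0 x))"
    and local_hollows_conv: "\<And>a::real. 0 < a \<Longrightarrow>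
      (\<lambda>n. emeasure lebesgue
             (sym_diff (hollows_below \<infinity> (\<phi> n)) (hollows_below \<infinity> \<phi>\<^sub>0) \<inter> {0..a})) \<longlonglongrightarrow> 0"
begin

sublocale tampable_convergent \<phi>\<^sub>0 \<phi>
proof -
  have "0 < p" using p by simp
  then have "tampable \<phi>\<^sub>0" "\<And>n. tampable (\<phi> n)"
    using conv tampable_if_in_Lp unfolding Lp_tendsto_def by blast+
  then show "tampable_convergent \<phi>\<^sub>0 \<phi>"
    using local_hollows_conv by (simp add: tampable_convergent_def tampable_convergent_axioms_def del: emeasure_completion)
qed

lemma conv_real:
  "(\<integral>\<^sup>+x. ennreal (\<bar>\<phi> n x\<bar> powr p) \<partial>lebesgue_on {0..}) < \<infinity>"
  "(\<integral>\<^sup>+x. ennreal (\<bar>\<phi>\<^sub>0 x\<bar> powr p) \<partial>lebesgue_on {0..}) < \<infinity>"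
  "(\<lambda>n. \<integral>\<^sup>+x. ennreal (\<bar>\<phi> n x - \<phi>\<^sub>0 x\<bar> powr p) \<partial>lebesgue_on {0..}) \<longlonglongrightarrow> 0"
proof -
  have "0 < p" using p by simp
  from Lp_tendsto_real_iff[OF this, of "\<lambda>n x. ereal (\<phi> n x)" \<phi> "\<lambda>x. ereal (\<phi>\<^sub>0 x)" \<phi>\<^sub>0]
  show "(\<integral>\<^sup>+x. ennreal (\<bar>\<phi> n x\<bar> powr p) \<partial>lebesgue_on {0..}) < \<infinity>"
    "(\<integral>\<^sup>+x. ennreal (\<bar>\<phi>\<^sub>0 x\<bar> powr p) \<partial>lebesgue_on {0..}) < \<infinity>"
    "(\<lambda>n. \<integral>\<^sup>+x. ennreal (\<bar>\<phi> n x - \<phi>\<^sub>0 x\<bar> powr p) \<partial>lebesgue_on {0..}) \<longlonglongrightarrow> 0"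
    using conv seq.meas lim.meas by (auto simp del: infinity_ennreal_def)
qed

text \<open>L^p convergence read on levels. It supplies the vanishing perturbation in the domination
  and the subsequence of almost everywhere convergent levels.\<close>

lemma nn_integral_level_weight_tendsto: "(\<lambda>n. integral\<^sup>N lborel (level_weight p (\<phi> n) \<phi>\<^sub>0)) \<longlonglongrightarrow> 0"
  using powr_tendsto_L1[OF p seq.meas lim.meas nonneg nonneg0 conv_real(2,3)]
  by (simp add: nn_integral_level_weight[OF p seq.meas lim.meas nonneg nonneg0])

text \<open>The tamped sets converge at almost every level and agree with the superlevel sets of the
  tampings up to null sets. Dominated convergence over the levels gives L^1 convergence of the p-th
  powers, hence L^p convergence.\<close>

lemma tamping_tendsto:
  assumes AE_conv: "AE \<nu> in lebesgue_on {0..}.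
        (\<lambda>n. emeasure lebesgue (sym_diff (superlevel (\<phi> n) \<nu>) (superlevel \<phi>\<^sub>0 \<nu>))) \<longlonglongrightarrow> 0"
  shows "AE \<nu> in lebesgue_on {0..}.
        (\<lambda>n. emeasure lebesgue
               (sym_diff (superlevel (tamping (\<phi> n)) (ereal \<nu>))
                         (superlevel (tamping \<phi>\<^sub>0) (ereal \<nu>)))) \<longlonglongrightarrow> 0"
    and "Lp_tendsto p (\<lambda>n. tamping (\<phi> n)) (tamping \<phi>\<^sub>0)"
proof -
  have AE_tamp: "AE \<nu> in lborel. 0 < \<nu> \<longrightarrow>
      (\<lambda>n. emeasure lebesgue (sym_diff (tamp_set (\<phi> n) \<nu>) (tamp_set \<phi>\<^sub>0 \<nu>))) \<longlonglongrightarrow> 0"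
    using AE_conv unfolding AE_half_line_iff
    by (rule eventually_mono) (use tamp_set_tendsto in blast)
  have eq: "emeasure lebesgue (sym_diff (superlevel (tamping (\<phi> n)) (ereal \<nu>)) (superlevel (tamping \<phi>\<^sub>0) (ereal \<nu>)))
      = emeasure lebesgue (sym_diff (tamp_set (\<phi> n) \<nu>) (tamp_set \<phi>\<^sub>0 \<nu>))" if "0 < \<nu>" for n \<nu>
    using that
    by (intro emeasure_sym_diff_cong_AE sets_superlevel seq.superlevel_tamping_AE lim.superlevel_tamping_AE
        seq.tamping_measurable lim.tamping_measurable seq.tamp_set_sets lim.tamp_set_sets)
  have eq_real: "emeasure lebesgue (sym_diff (superlevel (seq.tamping_real n) \<nu>) (superlevel lim.tamping_real \<nu>))
      = emeasure lebesgue (sym_diff (tamp_set (\<phi> n) \<nu>) (tamp_set \<phi>\<^sub>0 \<nu>))" if "0 < \<nu>" for n \<nu>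
    using that
    by (intro emeasure_sym_diff_cong_AE sets_superlevel seq.superlevel_tamping_real_AE lim.superlevel_tamping_real_AE
        seq.tamping_real_measurable lim.tamping_real_measurable seq.tamp_set_sets lim.tamp_set_sets)
  show "AE \<nu> in lebesgue_on {0..}.
        (\<lambda>n. emeasure lebesgue
               (sym_diff (superlevel (tamping (\<phi> n)) (ereal \<nu>))
                         (superlevel (tamping \<phi>\<^sub>0) (ereal \<nu>)))) \<longlonglongrightarrow> 0"
    unfolding AE_half_line_iff using AE_tamp by eventually_elim (simp add: eq del: emeasure_completion)
  \<comment> \<open>Equal measures bound the symmetric difference of the tamped sets by |A_n| + |A|,
    and |A_n| \<le> |A| + |A_n \<triangle> A|. The first term is integrable over the levels, the
    second has vanishing integral.\<close>
  have le: "level_weight p (seq.tamping_real n) lim.tamping_real \<nu>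
      \<le> 2 * level_weight p \<phi>\<^sub>0 (\<lambda>_. 0) \<nu> + level_weight p (\<phi> n) \<phi>\<^sub>0 \<nu>" for n \<nu>
  proof (cases "0 < \<nu>")
    case True
    let ?A = "superlevel (\<phi> n) \<nu>" and ?B = "superlevel \<phi>\<^sub>0 \<nu>" and ?S = "tamp_set (\<phi> n) \<nu>" and ?T = "tamp_set \<phi>\<^sub>0 \<nu>"
    have sets: "?A \<in> sets lebesgue" "?B \<in> sets lebesgue" "?S \<in> sets lebesgue" "?T \<in> sets lebesgue"
      using True seq.tamp_set_sets lim.tamp_set_sets by auto
    have "emeasure lebesgue (sym_diff ?S ?T) \<le> emeasure lebesgue (?S \<union> ?T)"
      using sets by (intro emeasure_mono) auto
    also have "\<dots> \<le> emeasure lebesgue ?S + emeasure lebesgue ?T"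
      by (rule emeasure_subadditive) (use sets in auto)
    also have "\<dots> = emeasure lebesgue ?A + emeasure lebesgue ?B"
      using True by (simp only: seq.emeasure_tamp_set lim.emeasure_tamp_set)
    also have "emeasure lebesgue ?A \<le> emeasure lebesgue (?B \<union> sym_diff ?A ?B)"
      using sets by (intro emeasure_mono) auto
    also have "\<dots> \<le> emeasure lebesgue ?B + emeasure lebesgue (sym_diff ?A ?B)"
      by (rule emeasure_subadditive) (use sets in auto)
    finally have "emeasure lebesgue (sym_diff ?S ?T)
        \<le> 2 * emeasure lebesgue ?B + emeasure lebesgue (sym_diff ?A ?B)"
      by (simp add: mult_2 add_ac del: emeasure_completion)
    then have "ennreal (p * \<nu> powr (p - 1)) * emeasure lebesgue (sym_diff ?S ?T)
        \<le> ennreal (p * \<nu> powr (p - 1)) * (2 * emeasure lebesgue ?B + emeasure lebesgue (sym_diff ?A ?B))"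
      by (rule mult_left_mono) simp
    moreover have "level_weight p (seq.tamping_real n) lim.tamping_real \<nu>
        = ennreal (p * \<nu> powr (p - 1)) * emeasure lebesgue (sym_diff ?S ?T)"
      using True by (simp add: level_weight_def eq_real del: emeasure_completion)
    moreover have "superlevel (\<lambda>_. 0) \<nu> = {}" using True by (auto simp: superlevel_def)
    then have "2 * level_weight p \<phi>\<^sub>0 (\<lambda>_. 0) \<nu> + level_weight p (\<phi> n) \<phi>\<^sub>0 \<nu>
        = ennreal (p * \<nu> powr (p - 1)) * (2 * emeasure lebesgue ?B + emeasure lebesgue (sym_diff ?A ?B))"
      using True by (simp add: level_weight_def distrib_left mult_ac del: emeasure_completion)
    ultimately show ?thesis by (simp only:)
  qed (simp add: level_weight_def)
  have "(\<lambda>n. integral\<^sup>N lborel (level_weight p (seq.tamping_real n) lim.tamping_real)) \<longlonglongrightarrow> 0"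
  proof (rule nn_integral_dominated_convergence_perturbed)
    show "AE \<nu> in lborel. level_weight p (seq.tamping_real n) lim.tamping_real \<nu>
      \<le> 2 * level_weight p \<phi>\<^sub>0 (\<lambda>_. 0) \<nu> + level_weight p (\<phi> n) \<phi>\<^sub>0 \<nu>" for n
      using le by simp
    show "(\<integral>\<^sup>+\<nu>. 2 * level_weight p \<phi>\<^sub>0 (\<lambda>_. 0) \<nu> \<partial>lborel) < \<infinity>"
      using conv_real(2) level_weight_measurable[OF lim.meas, of "\<lambda>_. 0" p]
      by (subst nn_integral_cmult) (auto simp: nn_integral_level_weight_0[OF p lim.meas nonneg0] ennreal_mult_less_top)
    show "AE \<nu> in lborel. (\<lambda>n. level_weight p (seq.tamping_real n) lim.tamping_real \<nu>) \<longlonglongrightarrow> 0"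
      using AE_tamp
    proof eventually_elim
      case (elim \<nu>)
      show ?case
      proof (cases "0 < \<nu>")
        case True
        have "(\<lambda>n. ennreal (p * \<nu> powr (p - 1)) * emeasure lebesgue (sym_diff (tamp_set (\<phi> n) \<nu>) (tamp_set \<phi>\<^sub>0 \<nu>)))
            \<longlonglongrightarrow> ennreal (p * \<nu> powr (p - 1)) * 0"
          using True elim by (intro ennreal_tendsto_cmult) auto
        then show ?thesis using True by (simp add: level_weight_def eq_real del: emeasure_completion)
      qed (simp add: level_weight_def)
    qed
    show "(\<lambda>\<nu>. 2 * level_weight p \<phi>\<^sub>0 (\<lambda>_. 0) \<nu>) \<in> borel_measurable lborel"
      using level_weight_measurable[OF lim.meas, of "\<lambda>_. 0" p] by measurable
  qed (intro level_weight_measurable seq.tamping_real_measurable lim.tamping_real_measurable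
      seq.meas lim.meas nn_integral_level_weight_tendsto)+
  then have lim: "(\<lambda>n. \<integral>\<^sup>+x. ennreal \<bar>seq.tamping_real n x powr p - lim.tamping_real x powr p\<bar> \<partial>lebesgue_on {0..}) \<longlonglongrightarrow> 0"
    using nn_integral_level_weight[OF p seq.tamping_real_measurable lim.tamping_real_measurable]
      seq.tamping_real_nonneg lim.tamping_real_nonneg by simp
  have "(\<lambda>n. \<integral>\<^sup>+x. ennreal (\<bar>seq.tamping_real n x - lim.tamping_real x\<bar> powr p) \<partial>lebesgue_on {0..}) \<longlonglongrightarrow> 0"
  proof (rule tendsto_sandwich[OF _ _ tendsto_const lim])
    show "\<forall>\<^sub>F n in sequentially. (\<integral>\<^sup>+x. ennreal (\<bar>seq.tamping_real n x - lim.tamping_real x\<bar> powr p) \<partial>lebesgue_on {0..})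
      \<le> (\<integral>\<^sup>+x. ennreal \<bar>seq.tamping_real n x powr p - lim.tamping_real x powr p\<bar> \<partial>lebesgue_on {0..})"
      by (intro always_eventually allI nn_integral_mono ennreal_leI abs_diff_powr_le p
          seq.tamping_real_nonneg lim.tamping_real_nonneg)
  qed simp
  moreover have "0 < p" using p by simp
  ultimately show "Lp_tendsto p (\<lambda>n. tamping (\<phi> n)) (tamping \<phi>\<^sub>0)"
    using conv_real(1,2) seq.nn_integral_tamping_real[OF p nonneg] lim.nn_integral_tamping_real[OF p nonneg0]
    by (subst Lp_tendsto_real_iff[OF _ seq.tamping_measurable seq.tamping_eq_real lim.tamping_measurable lim.tamping_eq_real])
      (simp_all del: infinity_ennreal_def)
qed

text \<open>The weighted measures tend to 0 in L^1 over the levels, so a subsequence converges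
  almost everywhere; the weight is positive at positive levels and can be divided out.\<close>

lemma superlevel_AE_subseq:
  "\<exists>r. strict_mono r \<and> (AE \<nu> in lebesgue_on {0..}.
    (\<lambda>k. emeasure lebesgue (sym_diff (superlevel (\<phi> (r k)) \<nu>) (superlevel \<phi>\<^sub>0 \<nu>))) \<longlonglongrightarrow> 0)"
proof -
  obtain r where r: "strict_mono r" "AE \<nu> in lborel. (\<lambda>k. level_weight p (\<phi> (r k)) \<phi>\<^sub>0 \<nu>) \<longlonglongrightarrow> 0"
    using nn_integral_tendsto_0_AE_subseq[OF level_weight_measurable[OF seq.meas lim.meas] nn_integral_level_weight_tendsto]
    by blast
  have "AE \<nu> in lebesgue_on {0..}.
    (\<lambda>k. emeasure lebesgue (sym_diff (superlevel (\<phi> (r k)) \<nu>) (superlevel \<phi>\<^sub>0 \<nu>))) \<longlonglongrightarrow> 0"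
    unfolding AE_half_line_iff
    using r(2)
  proof eventually_elim
    case (elim \<nu>)
    show ?case
    proof
      assume \<nu>: "0 < \<nu>"
      define c where "c = p * \<nu> powr (p - 1)"
      have c: "0 < c" using \<nu> p by (simp add: c_def)
      have "ennreal (1 / c) * (ennreal c * D) = D" for D
        using c by (simp add: mult.assoc[symmetric] ennreal_mult[symmetric])
      then have D: "ennreal (1 / c) * level_weight p (\<phi> (r k)) \<phi>\<^sub>0 \<nu>
          = emeasure lebesgue (sym_diff (superlevel (\<phi> (r k)) \<nu>) (superlevel \<phi>\<^sub>0 \<nu>))" for k
        using \<nu> by (simp add: level_weight_def c_def[symmetric] del: emeasure_completion)
      have "(\<lambda>k. ennreal (1 / c) * level_weight p (\<phi> (r k)) \<phi>\<^sub>0 \<nu>) \<longlonglongrightarrow> ennreal (1 / c) * 0"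
        using elim by (intro ennreal_tendsto_cmult) auto
      then show "(\<lambda>k. emeasure lebesgue (sym_diff (superlevel (\<phi> (r k)) \<nu>) (superlevel \<phi>\<^sub>0 \<nu>))) \<longlonglongrightarrow> 0"
        unfolding D by simp
    qed
  qed
  with r(1) show ?thesis by blast
qed

text \<open>All hypotheses pass to subsequences, so \<open>tamping_tendsto\<close> is available
  along the extracted one.\<close>

lemma Lp_tampable_convergent_subseq:
  assumes "strict_mono r"
  shows "Lp_tampable_convergent p (\<lambda>k. \<phi> (r k)) \<phi>\<^sub>0"
proof
  show "Lp_tendsto p (\<lambda>k x. ereal (\<phi> (r k) x)) (\<lambda>x. ereal (\<phi>\<^sub>0 x))"
    using conv LIMSEQ_subseq_LIMSEQ[OF _ assms] unfolding Lp_tendsto_def by (auto simp: o_def)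
  fix a :: real assume "0 < a"
  from LIMSEQ_subseq_LIMSEQ[OF local_hollows_conv[OF this] assms]
  show "(\<lambda>k. emeasure lebesgue (sym_diff (hollows_below \<infinity> (\<phi> (r k))) (hollows_below \<infinity> \<phi>\<^sub>0) \<inter> {0..a})) \<longlonglongrightarrow> 0"
    by (simp only: o_def)
qed (use p nonneg nonneg0 in auto)

end

theorem theorem3p10:
  fixes p :: real and \<phi> :: "nat \<Rightarrow> real \<Rightarrow> real" and \<phi>\<^sub>0 :: "real \<Rightarrow> real"
  assumes p: "1 \<le> p"
    and nonneg: "\<And>n. AE x in lebesgue_on {0..}. 0 \<le> \<phi> n x"
    and nonneg0: "AE x in lebesgue_on {0..}. 0 \<le> \<phi>\<^sub>0 x"
    and conv: "Lp_tendsto p (\<lambda>n x. ereal (\<phi> n x)) (\<lambda>x. ereal (\<phi>\<^sub>0 x))"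
    and hollows_conv: "\<And>a::real. 0 < a \<Longrightarrow>
      (\<lambda>n. emeasure lebesgue
             (sym_diff (hollows_below \<infinity> (\<phi> n)) (hollows_below \<infinity> \<phi>\<^sub>0) \<inter> {0..a})) \<longlonglongrightarrow> 0"
  shows "(\<exists>r. strict_mono r \<and> Lp_tendsto p (\<lambda>k. tamping (\<phi> (r k))) (tamping \<phi>\<^sub>0)) \<and>
    ((AE \<nu> in lebesgue_on {0..}.
        (\<lambda>n. emeasure lebesgue (sym_diff (superlevel (\<phi> n) \<nu>) (superlevel \<phi>\<^sub>0 \<nu>))) \<longlonglongrightarrow> 0) \<longrightarrow>
     (AE \<nu> in lebesgue_on {0..}.
        (\<lambda>n. emeasure lebesgue
               (sym_diff (superlevel (tamping (\<phi> n)) (ereal \<nu>))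
                         (superlevel (tamping \<phi>\<^sub>0) (ereal \<nu>)))) \<longlonglongrightarrow> 0) \<and>
     Lp_tendsto p (\<lambda>n. tamping (\<phi> n)) (tamping \<phi>\<^sub>0))"
proof -
  interpret Lp_tampable_convergent p \<phi> \<phi>\<^sub>0
    by unfold_locales fact+
  \<comment> \<open>Along this subsequence the extra hypothesis of the second claim holds, so the
    first claim is an instance of the second.\<close>
  obtain r where r: "strict_mono r" "AE \<nu> in lebesgue_on {0..}.
      (\<lambda>k. emeasure lebesgue (sym_diff (superlevel (\<phi> (r k)) \<nu>) (superlevel \<phi>\<^sub>0 \<nu>))) \<longlonglongrightarrow> 0"
    using superlevel_AE_subseq by blast
  have "Lp_tendsto p (\<lambda>k. tamping (\<phi> (r k))) (tamping \<phi>\<^sub>0)"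
    by (rule Lp_tampable_convergent.tamping_tendsto(2)[OF Lp_tampable_convergent_subseq[OF r(1)] r(2)])
  then show ?thesis using r(1) tamping_tendsto by blast
qed

end
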